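(* Let $M=(\mathbb{C}^* )^n\times U$ with $U\subset\mathbb{C}^m$ open and convex, let $\rho$ be a $T$-invariant strictly plurisubharmonic function on $M$, let $\omega=\sqrt{-1}\,\partial\bar\partial\rho$, and let $\Phi=(\phi_1,\dots,\phi_n)$ be the moment map with $\phi_j=z_j\,\partial\rho/\partial z_j$. For $\lambda\in\mathbb{R}^n$, the reduced symplectic form on $M_\lambda=\Phi^{-1}(\lambda)/T$ is, in the local holomorphic coordinates $w=(w_1,\dots,w_m)$ on $M_\lambda$, $$\omega_\lambda=\sqrt{-1}\,\partial_w\bar\partial_w\,\rho_\lambda,\qquad \rho_\lambda=\iota_\lambda^*\Big(\rho-\sum_{j=1}^n\lambda_j\log t_j\Big),\quad t_j=|z_j|^2.$$
   Context: $T=(S^1)^n$ acts on $M=(\mathbb{C}^* )^n\times U$ by multiplication on $(\mathbb{C}^* )^n$; $z_1,\dots,z_n$ and $w_1,\dots,w_m$ are the coordinates on $(\mathbb{C}^* )^n$ and $U$. A $T$-invariant function is one of the form $\rho(t_1,\dots,t_n,w_1,\dots,w_m)$ with $t_i=|z_i|^2$ (smooth, not necessarily holomorphic, in $w$). $\iota_\lambda$ denotes the inclusion of $\Phi^{-1}(\lambda)$ in $M$ and $\pi:M\to U$ the projection. The map $\pi\circ\iota_\lambda$ is $T$-invariant and identifies $M_\lambda=\Phi^{-1}(\lambda)/T$ locally with $U$; via this identification $w_1,\dots,w_m$ are local holomorphic coordinates on $M_\lambda$, and $\iota_\lambda^*u$, for a $T$-invariant function $u$ on $M$, is regarded as a function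 of $w$. The reduced form $\omega_\lambda$ on $M_\lambda$ is the form whose pull-back to $\Phi^{-1}(\lambda)$ is $\iota_\lambda^*\omega$. *)

theory Defs
  imports "HOL-Analysis.Analysis"
begin

section \<open>Smooth functions and Wirtinger calculus on \<open>\<complex>\<^sup>k\<close>\<close>

text \<open>Intended for open \<open>S\<close>. Class \<open>C\<^sup>k\<close> is expressed through iterated directional derivatives,
  in the real sense.\<close>

fun Ck_on :: "nat \<Rightarrow> ('a::real_normed_vector \<Rightarrow> 'b::real_normed_vector) \<Rightarrow> 'a set \<Rightarrow> bool" where
  "Ck_on 0 f S \<longleftrightarrow> continuous_on S f"
| "Ck_on (Suc k) f S \<longleftrightarrow>
     (\<forall>x\<in>S. f differentiable (at x)) \<and> (\<forall>v. Ck_on k (\<lambda>x. frechet_derivative f (at x) v) S)"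

definition smooth_on :: "'a::real_normed_vector set \<Rightarrow> ('a \<Rightarrow> 'b::real_normed_vector) \<Rightarrow> bool" where
  "smooth_on S f \<longleftrightarrow> (\<forall>k. Ck_on k f S)"

text \<open>Writing \<open>z\<^sup>*\<close> for the conjugate of \<open>z\<close>: \<open>\<partial>/\<partial>z\<^sub>a = (\<partial>/\<partial>x\<^sub>a - \<i> \<partial>/\<partial>y\<^sub>a)/2\<close> and \<open>\<partial>/\<partial>z\<^sup>*\<^sub>a = (\<partial>/\<partial>x\<^sub>a + \<i> \<partial>/\<partial>y\<^sub>a)/2\<close>.\<close>

definition pd_z :: "'k::finite \<Rightarrow> (complex^'k \<Rightarrow> complex) \<Rightarrow> complex^'k \<Rightarrow> complex" where
  "pd_z a f p = (frechet_derivative f (at p) (axis a 1)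
                 - \<i> * frechet_derivative f (at p) (axis a \<i>)) / 2"

definition pd_zbar :: "'k::finite \<Rightarrow> (complex^'k \<Rightarrow> complex) \<Rightarrow> complex^'k \<Rightarrow> complex" where
  "pd_zbar a f p = (frechet_derivative f (at p) (axis a 1)
                    + \<i> * frechet_derivative f (at p) (axis a \<i>)) / 2"

definition levi_coeff :: "(complex^'k::finite \<Rightarrow> real) \<Rightarrow> complex^'k \<Rightarrow> 'k \<Rightarrow> 'k \<Rightarrow> complex" where
  "levi_coeff u p a b = pd_z a (pd_zbar b (\<lambda>q. complex_of_real (u q))) p"

text \<open>The 2-form \<open>\<i> \<Sum>\<^sub>a\<^sub>b (\<partial>\<^sup>2u/\<partial>z\<^sub>a\<partial>z\<^sup>*\<^sub>b) dz\<^sub>a \<and> dz\<^sup>*\<^sub>b\<close>, where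
  \<open>(\<alpha> \<and> \<beta>)(X,Y) = \<alpha>(X) \<beta>(Y) - \<alpha>(Y) \<beta>(X)\<close>; tangent vectors are elements of \<open>\<complex>\<^sup>k\<close>, regarded as a
  real vector space.\<close>

definition i_ddbar :: "(complex^'k::finite \<Rightarrow> real) \<Rightarrow> complex^'k \<Rightarrow> complex^'k \<Rightarrow> complex^'k \<Rightarrow> complex" where
  "i_ddbar u p X Y =
     \<i> * (\<Sum>a\<in>UNIV. \<Sum>b\<in>UNIV. levi_coeff u p a b * (X $ a * cnj (Y $ b) - Y $ a * cnj (X $ b)))"

text \<open>The Levi form of a real function is Hermitian, so its value on the diagonal is real.\<close>

definition strictly_psh_on :: "(complex^'k::finite) set \<Rightarrow> (complex^'k \<Rightarrow> real) \<Rightarrow> bool" where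
  "strictly_psh_on S u \<longleftrightarrow>
     (\<forall>p\<in>S. \<forall>X. X \<noteq> 0 \<longrightarrow> 0 < Re (\<Sum>a\<in>UNIV. \<Sum>b\<in>UNIV. levi_coeff u p a b * X $ a * cnj (X $ b)))"

definition two_form_on :: "'a::real_vector set \<Rightarrow> ('a \<Rightarrow> 'a \<Rightarrow> 'a \<Rightarrow> complex) \<Rightarrow> bool" where
  "two_form_on S \<sigma> \<longleftrightarrow> (\<forall>w\<in>S. bilinear (\<sigma> w) \<and> (\<forall>X. \<sigma> w X X = 0))"

text \<open>Velocities of curves lying in \<open>S\<close>; for an embedded submanifold this is its tangent space.\<close>

definition tangent_vectors :: "'a::real_normed_vector set \<Rightarrow> 'a \<Rightarrow> 'a set" where
  "tangent_vectors S p = {X. \<exists>\<gamma>::real \<Rightarrow> 'a. \<gamma> 0 = p \<and> (\<exists>e>0. \<forall>s. \<bar>s\<bar> < e \<longrightarrow> \<gamma> s \<in> S) \<and>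
                             (\<gamma> has_vector_derivative X) (at 0)}"


section \<open>The manifold \<open>M = (\<complex>\<^sup>*)\<^sup>n \<times> U\<close> with its torus action\<close>

text \<open>A point of \<open>\<complex>\<^sup>n \<times> \<complex>\<^sup>m\<close> is a vector \<open>p\<close> indexed by the sum type: \<open>z\<^sub>i = p $ Inl i\<close> and
  \<open>w\<^sub>a = p $ Inr a\<close>. The projection \<open>\<pi> : M \<rightarrow> U\<close> is linear and hence is its own derivative.\<close>

definition proj_w :: "complex^('n::finite + 'm::finite) \<Rightarrow> complex^'m" where
  "proj_w p = (\<chi> a. p $ Inr a)"

definition mfd :: "(complex^'m::finite) set \<Rightarrow> (complex^('n::finite + 'm)) set" where
  "mfd U = {p. (\<forall>i. p $ Inl i \<noteq> 0) \<and> proj_w p \<in> U}"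

definition tcoord :: "complex^('n::finite + 'm::finite) \<Rightarrow> real^'n" where
  "tcoord p = (\<chi> i. (cmod (p $ Inl i))\<^sup>2)"

definition T_invariant_on ::
    "(complex^('n::finite + 'm::finite)) set \<Rightarrow> (complex^('n + 'm) \<Rightarrow> real) \<Rightarrow> bool" where
  "T_invariant_on S u \<longleftrightarrow> (\<exists>f. \<forall>p\<in>S. u p = f (tcoord p) (proj_w p))"

definition torus :: "(complex^'n::finite) set" where
  "torus = {\<theta>. \<forall>i. cmod (\<theta> $ i) = 1}"

definition torus_act ::
    "complex^'n::finite \<Rightarrow> complex^('n + 'm::finite) \<Rightarrow> complex^('n + 'm)" where
  "torus_act \<theta> p = (\<chi> k. case k of Inl i \<Rightarrow> \<theta> $ i * p $ Inl i | Inr a \<Rightarrow> p $ Inr a)"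

definition torus_orbit ::
    "complex^('n::finite + 'm::finite) \<Rightarrow> (complex^('n + 'm)) set" where
  "torus_orbit p = (\<lambda>\<theta>. torus_act \<theta> p) ` torus"


section \<open>Moment map and reduction\<close>

definition moment ::
    "(complex^('n::finite + 'm::finite) \<Rightarrow> real) \<Rightarrow> complex^('n + 'm) \<Rightarrow> complex^'n" where
  "moment \<rho> p = (\<chi> j. p $ Inl j * pd_z (Inl j) (\<lambda>q. complex_of_real (\<rho> q)) p)"

definition level_set :: "(complex^'m::finite) set \<Rightarrow> (complex^('n::finite + 'm) \<Rightarrow> real) \<Rightarrow> real^'n
    \<Rightarrow> (complex^('n + 'm)) set" where
  "level_set U \<rho> l = {p \<in> mfd U. \<forall>j. moment \<rho> p $ j = complex_of_real (l $ j)}"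

definition reduced_space :: "(complex^'m::finite) set \<Rightarrow> (complex^('n::finite + 'm) \<Rightarrow> real) \<Rightarrow> real^'n
    \<Rightarrow> (complex^('n + 'm)) set set" where
  "reduced_space U \<rho> l = torus_orbit ` level_set U \<rho> l"

text \<open>The map \<open>M\<^sub>\<lambda> \<rightarrow> U\<close> induced by the \<open>T\<close>-invariant map \<open>\<pi> \<circ> \<iota>\<^sub>\<lambda>\<close>, which provides the coordinates
  \<open>w\<close> on \<open>M\<^sub>\<lambda>\<close>, and its image.\<close>

definition w_chart :: "(complex^('n::finite + 'm::finite)) set \<Rightarrow> complex^'m" where
  "w_chart Q = (THE w. proj_w ` Q = {w})"

definition chart_image :: "(complex^'m::finite) set \<Rightarrow> (complex^('n::finite + 'm) \<Rightarrow> real) \<Rightarrow> real^'n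
    \<Rightarrow> (complex^'m) set" where
  "chart_image U \<rho> l = w_chart ` reduced_space U \<rho> l"

text \<open>\<open>\<iota>\<^sub>\<lambda>\<^sup>*u\<close> regarded as a function of \<open>w\<close>: the common value of \<open>u\<close> on the points of
  \<open>\<Phi>\<^sup>-\<^sup>1(\<lambda>)\<close> lying over \<open>w\<close>.\<close>

definition descended :: "(complex^'m::finite) set \<Rightarrow> (complex^('n::finite + 'm) \<Rightarrow> real) \<Rightarrow> real^'n
    \<Rightarrow> (complex^('n + 'm) \<Rightarrow> real) \<Rightarrow> complex^'m \<Rightarrow> real" where
  "descended U \<rho> l u w = (THE c. u ` {p \<in> level_set U \<rho> l. proj_w p = w} = {c})"

definition shifted_potential :: "(complex^('n::finite + 'm::finite) \<Rightarrow> real) \<Rightarrow> real^'n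
    \<Rightarrow> complex^('n + 'm) \<Rightarrow> real" where
  "shifted_potential \<rho> l p = \<rho> p - (\<Sum>j\<in>UNIV. l $ j * ln (tcoord p $ j))"

definition reduced_potential :: "(complex^'m::finite) set \<Rightarrow> (complex^('n::finite + 'm) \<Rightarrow> real) \<Rightarrow> real^'n
    \<Rightarrow> complex^'m \<Rightarrow> real" where
  "reduced_potential U \<rho> l = descended U \<rho> l (shifted_potential \<rho> l)"

text \<open>\<open>\<sigma>\<close>, a 2-form in the coordinates \<open>w\<close> on \<open>M\<^sub>\<lambda>\<close>, is the reduced form of \<open>\<omega> = i_ddbar \<rho>\<close> if
  \<open>(\<pi> \<circ> \<iota>\<^sub>\<lambda>)\<^sup>*\<sigma> = \<iota>\<^sub>\<lambda>\<^sup>*\<omega>\<close> on \<open>\<Phi>\<^sup>-\<^sup>1(\<lambda>)\<close>.\<close>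

definition is_reduced_form :: "(complex^'m::finite) set \<Rightarrow> (complex^('n::finite + 'm) \<Rightarrow> real) \<Rightarrow> real^'n
    \<Rightarrow> (complex^'m \<Rightarrow> complex^'m \<Rightarrow> complex^'m \<Rightarrow> complex) \<Rightarrow> bool" where
  "is_reduced_form U \<rho> l \<sigma> \<longleftrightarrow>
     two_form_on (chart_image U \<rho> l) \<sigma> \<and>
     (\<forall>p \<in> level_set U \<rho> l.
        \<forall>X \<in> tangent_vectors (level_set U \<rho> l) p. \<forall>Y \<in> tangent_vectors (level_set U \<rho> l) p.
          \<sigma> (proj_w p) (proj_w X) (proj_w Y) = i_ddbar \<rho> p X Y)"

end

theory Submission
  imports Defs
begin

text \<open>Write \<open>z\<^sub>j = exp (x\<^sub>j + \<i> y\<^sub>j)\<close>. A torus-invariant potential does not depend on the angles \<open>y\<close>, so it is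
  a function \<open>F(x, w)\<close> on \<open>\<real>\<^sup>n \<times> U\<close>, and \<open>z\<^sub>j \<partial>/\<partial>z\<^sub>j\<close> becomes half of \<open>\<partial>/\<partial>x\<^sub>j\<close>: the moment map is half the
  gradient of \<open>F\<close> in \<open>x\<close> (\<open>moment_F\<close>). Along the fibres over \<open>U\<close> the Levi form is a quarter of the
  Hessian of \<open>F\<close> in \<open>x\<close>, so strict plurisubharmonicity makes \<open>F\<close> strictly convex in \<open>x\<close>
  (\<open>hess_F_positive\<close>). Hence the level equation \<open>\<partial>F/\<partial>x\<^sub>j = 2 l\<^sub>j\<close> has at most one solution \<open>x(w)\<close> for each
  \<open>w\<close>, and \<open>x\<close> is a smooth function on an open set of \<open>w\<close> (\<open>inj_moment_pair\<close>, \<open>Ck_on_lift\<close>). The level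
  set is the bundle of tori \<open>cmod z\<^sub>j = exp (x\<^sub>j(w))\<close> over that open set, which gives the chart.

  On the level set the shifted potential equals \<open>R(w) = F(x(w), w) - 2 l \<bullet> x(w)\<close>. By the choice of
  \<open>x(w)\<close> its derivative in direction \<open>V\<close> does not see the motion of \<open>x\<close>: it is the derivative of \<open>F\<close> in
  direction \<open>(0, V)\<close> (\<open>reduced_potential_has_derivative\<close>). Differentiating once more, the Hessian of \<open>R\<close>
  on \<open>(V, W)\<close> is the Hessian of \<open>F\<close> on the pair of the lifted vector \<open>(Dx V, V)\<close> and the vertical vector
  \<open>(0, W)\<close>.

  It remains to compare two forms. For every real \<open>u\<close> the form \<open>\<i> \<partial>\<partial>\<^sup>*u\<close>, with \<open>\<partial>\<^sup>*\<close> the conjugate of \<open>\<partial>\<close>, takes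
  the value \<open>(H(\<i>X, Y) - H(X, \<i>Y)) / 2\<close>, where \<open>H\<close> is the real Hessian of \<open>u\<close> (\<open>i_ddbar_hess\<close>). The
  passage from \<open>\<rho>\<close> to \<open>F\<close> adds to \<open>H\<close> a term that depends on \<open>X\<^sub>j Y\<^sub>j\<close> only and therefore cancels.
  Differentiating the level equation shows that the Hessian of \<open>F\<close> pairs lifted vectors to zero with
  \<open>(\<eta>, 0)\<close>; this removes the components along the torus, and what is left is the corresponding
  expression for \<open>R\<close> (\<open>i_ddbar_reduced\<close>). As the level set has tangent vectors over every \<open>w\<close>-direction
  (\<open>proj_tangent_surj\<close>), no other 2-form pulls back in this way.\<close>

section \<open>Calculus of \<open>C\<^sup>k\<close> functions\<close>

lemma Ck_on_subset: "Ck_on k f S \<Longrightarrow> T \<subseteq> S \<Longrightarrow> Ck_on k f T"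
  by (induction k arbitrary: f) (auto intro: continuous_on_subset)

lemma Ck_on_SucD: "Ck_on (Suc k) f S \<Longrightarrow> Ck_on k f S"
proof (induction k arbitrary: f)
  case 0
  then show ?case
    by (auto intro!: continuous_at_imp_continuous_on differentiable_imp_continuous_within)
next
  case (Suc k)
  then show ?case by (metis Ck_on.simps(2))
qed

lemma Ck_on_cong:
  assumes "open S" "\<And>x. x \<in> S \<Longrightarrow> f x = g x" "Ck_on k f S"
  shows "Ck_on k g S"
  using assms(2,3)
proof (induction k arbitrary: f g)
  case 0
  then show ?case by (auto cong: continuous_on_cong)
next
  case (Suc k)
  have D: "(g has_derivative frechet_derivative f (at x)) (at x)" if "x \<in> S" for x
  proof (rule has_derivative_transform_within_open[OF _ assms(1) that])
    show "(f has_derivative frechet_derivative f (at x)) (at x)"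
      using Suc.prems that by (simp add: frechet_derivative_works)
  qed (use Suc.prems in auto)
  then have E: "frechet_derivative f (at x) = frechet_derivative g (at x)" if "x \<in> S" for x
    using frechet_derivative_at that by blast
  have "Ck_on k (\<lambda>x. frechet_derivative g (at x) v) S" for v
    by (rule Suc.IH[of "\<lambda>x. frechet_derivative f (at x) v"]) (use Suc.prems E in auto)
  then show ?case using D by (auto simp: differentiable_def)
qed

text \<open>The introduction rule by which the closure properties below are proved: the derivative may be given
  in any form, instead of as the value of \<open>frechet_derivative\<close>.\<close>

lemma Ck_on_SucI:
  assumes S: "open S" and D: "\<And>x. x \<in> S \<Longrightarrow> (f has_derivative f' x) (at x)"
    and C: "\<And>v. Ck_on k (\<lambda>x. f' x v) S"
  shows "Ck_on (Suc k) f S"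
proof -
  have "f' x = frechet_derivative f (at x)" if "x \<in> S" for x
    using D[OF that] by (rule frechet_derivative_at)
  then have "Ck_on k (\<lambda>x. frechet_derivative f (at x) v) S" for v
    by (intro Ck_on_cong[OF S _ C]) auto
  then show ?thesis using D by (auto simp: differentiable_def)
qed

lemma Ck_on_SucE:
  assumes "Ck_on (Suc k) f S" "x \<in> S"
  shows "(f has_derivative frechet_derivative f (at x)) (at x)"
  using assms by (auto simp: frechet_derivative_works)

lemma Ck_on_const: "Ck_on k (\<lambda>x. c) S"
  by (induction k arbitrary: c) auto

lemma Ck_on_linear:
  assumes "open S" "bounded_linear L" "Ck_on k f S"
  shows "Ck_on k (\<lambda>x. L (f x)) S"
  using assms(3)
proof (induction k arbitrary: f)
  case 0
  then show ?case using assms(2) by (auto intro: bounded_linear.continuous_on)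
next
  case (Suc k)
  show ?case
  proof (rule Ck_on_SucI[OF assms(1)])
    show "((\<lambda>x. L (f x)) has_derivative (\<lambda>v. L (frechet_derivative f (at x) v))) (at x)"
      if "x \<in> S" for x
      using bounded_linear.has_derivative[OF assms(2) Ck_on_SucE[OF Suc.prems that]] .
  qed (use Suc in auto)
qed

lemma Ck_on_id:
  assumes "open S"
  shows "Ck_on k (\<lambda>x. x) S"
proof (cases k)
  case (Suc m)
  then show ?thesis
    by (auto intro: Ck_on_SucI[where f' = "\<lambda>x v. v"] assms Ck_on_const)
qed auto

lemma Ck_on_add:
  assumes "open S" "Ck_on k f S" "Ck_on k g S"
  shows "Ck_on k (\<lambda>x. f x + g x) S"
  using assms(2,3)
proof (induction k arbitrary: f g)
  case 0
  then show ?case by (auto intro: continuous_intros)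
next
  case (Suc k)
  show ?case
  proof (rule Ck_on_SucI[OF assms(1)])
    show "((\<lambda>x. f x + g x) has_derivative
        (\<lambda>v. frechet_derivative f (at x) v + frechet_derivative g (at x) v)) (at x)"
      if "x \<in> S" for x
      using has_derivative_add[OF Ck_on_SucE[OF Suc.prems(1) that] Ck_on_SucE[OF Suc.prems(2)
          that]] .
  qed (use Suc in auto)
qed

lemma Ck_on_sum:
  assumes "open S" "\<And>i. i \<in> I \<Longrightarrow> Ck_on k (f i) S"
  shows "Ck_on k (\<lambda>x. \<Sum>i\<in>I. f i x) S"
  using assms(2) by (induction I rule: infinite_finite_induct) (auto
      intro: Ck_on_add Ck_on_const assms(1))

lemma Ck_on_bilinear:
  assumes S: "open S" and P: "bounded_bilinear P" and "Ck_on k f S" "Ck_on k g S"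
  shows "Ck_on k (\<lambda>x. P (f x) (g x)) S"
  using assms(3,4)
proof (induction k arbitrary: f g)
  case 0
  then show ?case using P by (auto intro: bounded_bilinear.continuous_on)
next
  case (Suc k)
  have fg: "Ck_on k f S" "Ck_on k g S" using Suc.prems Ck_on_SucD by blast+
  show ?case
  proof (rule Ck_on_SucI[OF S])
    show "((\<lambda>x. P (f x) (g x)) has_derivative
       (\<lambda>v. P (f x) (frechet_derivative g (at x) v) +
           P (frechet_derivative f (at x) v) (g x))) (at x)"
      if "x \<in> S" for x
      by (rule bounded_bilinear.FDERIV[OF P]) (use Suc.prems that in \<open>auto intro: Ck_on_SucE\<close>)
    show "Ck_on k (\<lambda>x. P (f x) (frechet_derivative g (at x) v) +
          P (frechet_derivative f (at x) v) (g x)) S" for v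
      by (intro Ck_on_add[OF S] Suc.IH fg) (use Suc.prems in auto)
  qed
qed

lemmas Ck_on_mult = Ck_on_bilinear[OF _ bounded_bilinear_mult]
lemmas Ck_on_scaleR = Ck_on_bilinear[OF _ bounded_bilinear_scaleR]

lemma Ck_on_prod:
  fixes f :: "'i \<Rightarrow> 'a::real_normed_vector \<Rightarrow> real"
  assumes "open S" "\<And>i. i \<in> I \<Longrightarrow> Ck_on k (f i) S"
  shows "Ck_on k (\<lambda>x. \<Prod>i\<in>I. f i x) S"
  using assms(2) by (induction I rule: infinite_finite_induct) (auto
      intro: Ck_on_mult Ck_on_const assms(1))

text \<open>The derivative of \<open>1/f\<close> is \<open>- f' (1/f)\<^sup>2\<close>, in which \<open>1/f\<close> occurs again with one order of
  differentiability less, so induction on the order applies.\<close>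

lemma Ck_on_inverse:
  fixes f :: "'a::real_normed_vector \<Rightarrow> real"
  assumes S: "open S" and nz: "\<And>x. x \<in> S \<Longrightarrow> f x \<noteq> 0" and "Ck_on k f S"
  shows "Ck_on k (\<lambda>x. inverse (f x)) S"
  using assms(3)
proof (induction k)
  case 0
  then show ?case using nz by (auto intro: continuous_on_inverse)
next
  case (Suc k)
  have "Ck_on k (\<lambda>x. inverse (f x)) S" using Suc Ck_on_SucD by blast
  show ?case
  proof (rule Ck_on_SucI[OF S])
    show "((\<lambda>x. inverse (f x)) has_derivative
       (\<lambda>v. (-1) * (inverse (f x) * (frechet_derivative f (at x) v * inverse (f x))))) (at x)"
      if "x \<in> S" for x
      using Ck_on_SucE[OF Suc.prems that] nz[OF that]
      by (auto intro!: derivative_eq_intros)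
    show "Ck_on k (\<lambda>x. (-1) * (inverse (f x) * (frechet_derivative f (at x) v * inverse (f x))))
        S" for v
      by (intro Ck_on_mult Ck_on_const S \<open>Ck_on k (\<lambda>x. inverse (f x)) S\<close>) (use Suc.prems in auto)
  qed
qed

lemma Ck_on_exp: "Ck_on k (exp :: real \<Rightarrow> real) UNIV"
proof (induction k)
  case (Suc k)
  show ?case
    by (rule Ck_on_SucI[where f' = "\<lambda>x v. exp x * v"])
       (auto intro!: derivative_eq_intros Ck_on_mult Ck_on_const Suc.IH)
qed (auto intro: continuous_intros)

lemma linear_expand_Basis:
  fixes L :: "'a::euclidean_space \<Rightarrow> 'b::real_vector"
  assumes "linear L"
  shows "L v = (\<Sum>e\<in>Basis. (v \<bullet> e) *\<^sub>R L e)"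
proof -
  have "L v = L (\<Sum>e\<in>Basis. (v \<bullet> e) *\<^sub>R e)" by (simp add: euclidean_representation)
  then show ?thesis using assms by (simp add: linear_sum linear_cmul)
qed

text \<open>The derivative of \<open>f \<circ> g\<close> evaluates \<open>Df\<close> in a direction that moves with the point. Expanding this
  direction in the standard basis leaves only derivatives of \<open>f\<close> in fixed directions, composed with \<open>g\<close>,
  to which the induction hypothesis applies.\<close>

lemma Ck_on_compose:
  fixes f :: "'b::euclidean_space \<Rightarrow> 'c::real_normed_vector" and g :: "'a::real_normed_vector \<Rightarrow> 'b"
  assumes S: "open S" and T: "open T" and sub: "g ` S \<subseteq> T" and "Ck_on k f T" "Ck_on k g S"
  shows "Ck_on k (\<lambda>x. f (g x)) S"
  using assms(4,5)
proof (induction k arbitrary: f)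
  case 0
  then show ?case using sub continuous_on_compose2 by fastforce
next
  case (Suc k)
  have g: "Ck_on k g S" using Suc.prems Ck_on_SucD by blast
  show ?case
  proof (rule Ck_on_SucI[OF S])
    fix x assume x: "x \<in> S"
    have f': "(f has_derivative frechet_derivative f (at (g x))) (at (g x))"
      using Suc.prems(1) sub x by (auto intro!: Ck_on_SucE)
    have "((\<lambda>x. f (g x)) has_derivative
        (\<lambda>v. frechet_derivative f (at (g x)) (frechet_derivative g (at x) v))) (at x)"
      using has_derivative_compose[OF Ck_on_SucE[OF Suc.prems(2) x] f'] by simp
    moreover have "(\<lambda>v. frechet_derivative f (at (g x)) (frechet_derivative g (at x) v)) =
        (\<lambda>v. \<Sum>e\<in>Basis. (frechet_derivative g (at x) v \<bullet> e) *\<^sub>R frechet_derivative f (at (g x)) e)"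
      using linear_expand_Basis[OF has_derivative_linear[OF f']] by blast
    ultimately show "((\<lambda>x. f (g x)) has_derivative
        (\<lambda>v. \<Sum>e\<in>Basis. (frechet_derivative g (at x) v \<bullet> e) *\<^sub>R frechet_derivative f (at (g x))
            e)) (at x)"
      by simp
  next
    show "Ck_on k (\<lambda>x. \<Sum>e\<in>Basis. (frechet_derivative g (at x) v \<bullet> e) *\<^sub>R
                        frechet_derivative f (at (g x)) e) S" for v
      by (intro Ck_on_sum Ck_on_scaleR Ck_on_linear[where L = "\<lambda>y. y \<bullet> _"] S
            bounded_linear_inner_left Suc.IH g)
         (use Suc.prems in auto)
  qed
qed

lemma Ck_on_det:
  fixes A :: "'a::real_normed_vector \<Rightarrow> real^'n^'n"
  assumes "open S" "\<And>i j. Ck_on k (\<lambda>x. A x $ i $ j) S"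
  shows "Ck_on k (\<lambda>x. det (A x)) S"
  unfolding det_def by (intro Ck_on_sum Ck_on_mult Ck_on_const Ck_on_prod assms)

lemma Ck_on_vec:
  fixes f :: "'a::real_normed_vector \<Rightarrow> real^'n"
  assumes "open S" "\<And>i. Ck_on k (\<lambda>x. f x $ i) S"
  shows "Ck_on k f S"
proof -
  have "f x = (\<Sum>i\<in>UNIV. (f x $ i) *\<^sub>R axis i 1)" for x
    by (auto simp: vec_eq_iff axis_def if_distrib cong: if_cong)
  moreover have "Ck_on k (\<lambda>x. \<Sum>i\<in>UNIV. (f x $ i) *\<^sub>R axis i 1) S"
    by (intro Ck_on_sum Ck_on_scaleR Ck_on_const assms)
  ultimately show ?thesis by (rule_tac Ck_on_cong[OF assms(1)]) auto
qed

lemma Ck_on_Pair: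
  assumes "open S" "Ck_on k f S" "Ck_on k g S"
  shows "Ck_on k (\<lambda>x. (f x, g x)) S"
proof -
  have "Ck_on k (\<lambda>x. (f x, 0) + (0, g x)) S"
    by (intro Ck_on_add assms Ck_on_linear[where L = "\<lambda>y. (y, 0)"] Ck_on_linear[where L =
        "\<lambda>y. (0, y)"]
        bounded_linear_Pair bounded_linear_ident bounded_linear_zero)
  then show ?thesis by simp
qed

section \<open>The real Hessian and its symmetry\<close>

lemma smooth_on_Ck: "smooth_on S f \<Longrightarrow> Ck_on k f S"
  by (simp add: smooth_on_def)

lemma smooth_on_frechet: "smooth_on S f \<Longrightarrow> smooth_on S (\<lambda>x. frechet_derivative f (at x) v)"
  unfolding smooth_on_def by (metis Ck_on.simps(2))

lemma smooth_on_has_derivative: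
  "smooth_on S f \<Longrightarrow> x \<in> S \<Longrightarrow> (f has_derivative frechet_derivative f (at x)) (at x)"
  unfolding smooth_on_def by (metis Ck_on_SucE)

definition hess :: "('a::real_normed_vector \<Rightarrow> 'b::real_normed_vector) \<Rightarrow> 'a \<Rightarrow> 'a \<Rightarrow> 'a \<Rightarrow> 'b" where
  "hess f x u v = frechet_derivative (\<lambda>y. frechet_derivative f (at y) v) (at x) u"

lemma hess_has_derivative:
  assumes "smooth_on S f" "x \<in> S"
  shows "((\<lambda>y. frechet_derivative f (at y) v) has_derivative (\<lambda>u. hess f x u v)) (at x)"
  using smooth_on_has_derivative[OF smooth_on_frechet[OF assms(1)] assms(2)] unfolding hess_def .

lemma hess_eqI:
  assumes "open S" "x \<in> S" "\<And>y. y \<in> S \<Longrightarrow> (f has_derivative f' y) (at y)"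
    "((\<lambda>y. f' y v) has_derivative L) (at x)"
  shows "hess f x u v = L u"
proof -
  have "((\<lambda>y. frechet_derivative f (at y) v) has_derivative L) (at x)"
    by (rule has_derivative_transform_within_open[OF assms(4,1,2)])
       (use frechet_derivative_at[OF assms(3)] in simp)
  then show ?thesis unfolding hess_def by (simp add: frechet_derivative_at[symmetric])
qed

lemma linear_hess_left:
  assumes "smooth_on S f" "x \<in> S" shows "linear (\<lambda>u. hess f x u v)"
  using hess_has_derivative[OF assms] by (rule has_derivative_linear)

lemma linear_hess_right:
  assumes S: "open S" and f: "smooth_on S f" and x: "x \<in> S" shows "linear (hess f x u)"
proof -
  have lin: "linear (frechet_derivative f (at y))" if "y \<in> S" for y
    using smooth_on_has_derivative[OF f that] by (rule has_derivative_linear)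
  show ?thesis
  proof (rule linearI)
    fix v w
    have "((\<lambda>y. frechet_derivative f (at y) v + frechet_derivative f (at y) w)
       has_derivative (\<lambda>u. hess f x u v + hess f x u w)) (at x)"
      by (intro has_derivative_add hess_has_derivative[OF f x])
    then have "((\<lambda>y. frechet_derivative f (at y) (v + w))
       has_derivative (\<lambda>u. hess f x u v + hess f x u w)) (at x)"
      by (rule has_derivative_transform_within_open[OF _ S x]) (simp add: linear_add[OF lin])
    then show "hess f x u (v + w) = hess f x u v + hess f x u w"
      using has_derivative_unique[OF hess_has_derivative[OF f x]] by metis
  next
    fix c v
    have "((\<lambda>y. c *\<^sub>R frechet_derivative f (at y) v) has_derivative (\<lambda>u. c *\<^sub>R hess f x u v)) (at
        x)"
      by (intro has_derivative_scaleR_right hess_has_derivative[OF f x])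
    then have "((\<lambda>y. frechet_derivative f (at y) (c *\<^sub>R v))
       has_derivative (\<lambda>u. c *\<^sub>R hess f x u v)) (at x)"
      by (rule has_derivative_transform_within_open[OF _ S x]) (simp add: linear_cmul[OF lin])
    then show "hess f x u (c *\<^sub>R v) = c *\<^sub>R hess f x u v"
      using has_derivative_unique[OF hess_has_derivative[OF f x]] by metis
  qed
qed

text \<open>The second-order chain rule in the form in which it is used throughout: both the base point \<open>g y\<close>
  and the direction \<open>c y\<close> of the derivative move.\<close>

lemma has_derivative_moving_direction:
  fixes f :: "'b::euclidean_space \<Rightarrow> 'c::real_normed_vector"
  assumes S: "open S" and f: "smooth_on S f"
    and g: "(g has_derivative g') (at x)" and c: "(c has_derivative c') (at x)" and gx: "g x \<in> S"
  shows "((\<lambda>y. frechet_derivative f (at (g y)) (c y)) has_derivative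
     (\<lambda>u. hess f (g x) (g' u) (c x) + frechet_derivative f (at (g x)) (c' u))) (at x)"
proof -
  have lin: "linear (frechet_derivative f (at y))" if "y \<in> S" for y
    using smooth_on_has_derivative[OF f that] by (rule has_derivative_linear)
  have comp: "((\<lambda>y. frechet_derivative f (at (g y)) e) has_derivative (\<lambda>u. hess f (g x) (g' u)
      e)) (at x)" for e
    using has_derivative_compose[OF g hess_has_derivative[OF f gx]] by simp
  have "((\<lambda>y. \<Sum>e\<in>Basis. (c y \<bullet> e) *\<^sub>R frechet_derivative f (at (g y)) e) has_derivative
     (\<lambda>u. \<Sum>e\<in>Basis. (c x \<bullet> e) *\<^sub>R hess f (g x) (g' u) e +
              (c' u \<bullet> e) *\<^sub>R frechet_derivative f (at (g x)) e)) (at x)"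
    by (intro has_derivative_sum has_derivative_scaleR comp has_derivative_inner_left c)
  also have "(\<lambda>u. \<Sum>e\<in>Basis. (c x \<bullet> e) *\<^sub>R hess f (g x) (g' u) e +
              (c' u \<bullet> e) *\<^sub>R frechet_derivative f (at (g x)) e) =
     (\<lambda>u. hess f (g x) (g' u) (c x) + frechet_derivative f (at (g x)) (c' u))"
    by (simp add: sum.distrib linear_expand_Basis[OF linear_hess_right[OF S f gx], symmetric]
        linear_expand_Basis[OF lin[OF gx], symmetric])
  finally have D: "((\<lambda>y. \<Sum>e\<in>Basis. (c y \<bullet> e) *\<^sub>R frechet_derivative f (at (g y)) e) has_derivative
     (\<lambda>u. hess f (g x) (g' u) (c x) + frechet_derivative f (at (g x)) (c' u))) (at x)" .
  have "\<forall>\<^sub>F y in at x. g y \<in> S"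
    using has_derivative_continuous[OF g] S gx
    by (metis (mono_tags) continuous_at tendsto_def topological_tendstoD)
  then have ev: "\<forall>\<^sub>F y in at x. (\<Sum>e\<in>Basis. (c y \<bullet> e) *\<^sub>R frechet_derivative f (at (g y)) e) =
      frechet_derivative f (at (g y)) (c y)"
    by eventually_elim (simp add: linear_expand_Basis[OF lin, symmetric])
  show ?thesis
    by (rule has_derivative_transform_eventually[OF D ev])
       (simp_all add: linear_expand_Basis[OF lin[OF gx], symmetric])
qed

text \<open>The second difference over a parallelogram is symmetric in its two sides. Applying the mean value
  theorem first along \<open>u\<close> and then along \<open>v\<close> expresses it through the Hessian at an inner point, and letting
  the parallelogram shrink yields the symmetry of the Hessian.\<close>

lemma double_difference:
  fixes f :: "'a::real_normed_vector \<Rightarrow> real"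
  assumes f: "smooth_on S f" and h: "0 < h"
    and sub: "\<And>s t. 0 \<le> s \<Longrightarrow> s \<le> h \<Longrightarrow> 0 \<le> t \<Longrightarrow> t \<le> h \<Longrightarrow> x + s *\<^sub>R u + t *\<^sub>R v \<in> S"
  shows "\<exists>s t. 0 < s \<and> s < h \<and> 0 < t \<and> t < h \<and>
     f (x + h *\<^sub>R u + h *\<^sub>R v) - f (x + h *\<^sub>R u) - f (x + h *\<^sub>R v) + f x = h * h * hess f (x +
         s *\<^sub>R u + t *\<^sub>R v) v u"
proof -
  define \<phi> where "\<phi> s = f (x + s *\<^sub>R u + h *\<^sub>R v) - f (x + s *\<^sub>R u + 0 *\<^sub>R v)" for s
  have lin: "linear (frechet_derivative f (at y))" if "y \<in> S" for y
    using smooth_on_has_derivative[OF f that] by (rule has_derivative_linear)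
  have D1: "((\<lambda>s. f (x + s *\<^sub>R u + t *\<^sub>R v)) has_real_derivative
        frechet_derivative f (at (x + s *\<^sub>R u + t *\<^sub>R v)) u) (at s)"
    if "0 \<le> s" "s \<le> h" "0 \<le> t" "t \<le> h" for s t
  proof -
    have "((\<lambda>s. x + s *\<^sub>R u + t *\<^sub>R v) has_derivative (\<lambda>r. r *\<^sub>R u)) (at s)"
      by (auto intro!: derivative_eq_intros)
    from has_derivative_compose[OF this smooth_on_has_derivative[OF f sub[OF that]]]
    show ?thesis
      by (simp add: has_field_derivative_def linear_cmul[OF lin[OF sub[OF that]]] mult.commute[of
          _ "frechet_derivative _ _ _"])
  qed
  have "\<exists>s>0. s < h \<and> \<phi> h - \<phi> 0 = (h - 0) * (frechet_derivative f (at (x + s *\<^sub>R u + h *\<^sub>R v)) u -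
       frechet_derivative f (at (x + s *\<^sub>R u + 0 *\<^sub>R v)) u)"
    unfolding \<phi>_def
    by (rule MVT2[OF h]) (intro DERIV_diff D1; use h in auto)
  then obtain s where s: "0 < s" "s < h" and e1: "\<phi> h - \<phi> 0 = h * (frechet_derivative f (at (x +
      s *\<^sub>R u + h *\<^sub>R v)) u - 
       frechet_derivative f (at (x + s *\<^sub>R u + 0 *\<^sub>R v)) u)"
    by auto
  have D2: "((\<lambda>t. frechet_derivative f (at (x + s *\<^sub>R u + t *\<^sub>R v)) u) has_real_derivative
        hess f (x + s *\<^sub>R u + t *\<^sub>R v) v u) (at t)"
    if t: "0 \<le> t" "t \<le> h" for t
  proof -
    have inS: "x + s *\<^sub>R u + t *\<^sub>R v \<in> S" using s t by (auto intro: sub)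
    have "((\<lambda>t. x + s *\<^sub>R u + t *\<^sub>R v) has_derivative (\<lambda>r. r *\<^sub>R v)) (at t)"
      by (auto intro!: derivative_eq_intros)
    from has_derivative_compose[OF this hess_has_derivative[OF f inS]]
    show ?thesis
      by (simp add: has_field_derivative_def linear_cmul[OF linear_hess_left[OF f inS]]
          mult.commute[of _ "hess _ _ _ _"])
  qed
  have "\<exists>t>0. t < h \<and> frechet_derivative f (at (x + s *\<^sub>R u + h *\<^sub>R v)) u -
       frechet_derivative f (at (x + s *\<^sub>R u + 0 *\<^sub>R v)) u = (h - 0) * hess f (x + s *\<^sub>R u +
           t *\<^sub>R v) v u"
    by (rule MVT2[OF h]) (auto intro: D2)
  then obtain t where "0 < t" "t < h" "frechet_derivative f (at (x + s *\<^sub>R u + h *\<^sub>R v)) u -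
       frechet_derivative f (at (x + s *\<^sub>R u + 0 *\<^sub>R v)) u = h * hess f (x + s *\<^sub>R u + t *\<^sub>R v) v u"
    by auto
  with s e1 show ?thesis
    by (intro exI[of _ s] exI[of _ t]) (auto simp: \<phi>_def)
qed

lemma hess_symmetric:
  fixes f :: "'a::real_normed_vector \<Rightarrow> real"
  assumes S: "open S" and f: "smooth_on S f" and x: "x \<in> S"
  shows "hess f x u v = hess f x v u"
proof (rule ccontr)
  assume ne: "\<not> ?thesis"
  define \<epsilon> where "\<epsilon> = \<bar>hess f x u v - hess f x v u\<bar> / 2"
  have \<epsilon>: "\<epsilon> > 0" using ne by (simp add: \<epsilon>_def)
  have cont: "continuous (at x) (\<lambda>y. hess f y a b)" for a b
    using smooth_on_has_derivative[OF smooth_on_frechet[OF smooth_on_frechet[OF f]] x]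
    unfolding hess_def by (rule has_derivative_continuous)
  obtain r0 where r0: "r0 > 0" "ball x r0 \<subseteq> S" using S x open_contains_ball by blast
  obtain r1 where r1: "r1 > 0" "\<And>y. dist y x < r1 \<Longrightarrow> dist (hess f y u v) (hess f x u v) < \<epsilon>"
    using cont[unfolded continuous_at_eps_delta] \<epsilon> by metis
  obtain r2 where r2: "r2 > 0" "\<And>y. dist y x < r2 \<Longrightarrow> dist (hess f y v u) (hess f x v u) < \<epsilon>"
    using cont[unfolded continuous_at_eps_delta] \<epsilon> by metis
  define r where "r = min r0 (min r1 r2)"
  \<comment> \<open>With sides \<open>h u\<close> and \<open>h v\<close> the whole parallelogram lies within distance \<open>r / 2\<close> of \<open>x\<close>.\<close>
  define N where "N = norm u + norm v + 1"
  define h where "h = r / (2 * N)"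
  have rpos: "r > 0" using r0 r1 r2 by (simp add: r_def)
  have npos: "N > 0"
    unfolding N_def by (rule add_nonneg_pos) auto
  then have h: "h > 0" using rpos by (simp add: h_def)
  have near: "dist (x + s *\<^sub>R a + t *\<^sub>R b) x < r" if "0 \<le> s" "s \<le> h" "0 \<le> t" "t \<le> h"
      "(a = u \<and> b = v) \<or> (a = v \<and> b = u)" for s t a b
  proof -
    have "dist (x + s *\<^sub>R a + t *\<^sub>R b) x \<le> norm (s *\<^sub>R a) + norm (t *\<^sub>R b)"
      using norm_triangle_ineq[of "s *\<^sub>R a" "t *\<^sub>R b"] by (simp add: dist_norm add.assoc)
    also have "\<dots> \<le> h * norm a + h * norm b"
      using that by (auto intro!: add_mono mult_right_mono)
    also have "\<dots> \<le> h * N" using that(5) h by (auto simp: N_def algebra_simps)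
    also have "\<dots> = r / 2" using npos by (simp add: h_def)
    also have "\<dots> < r" using rpos by simp
    finally show ?thesis .
  qed
  have inS: "x + s *\<^sub>R a + t *\<^sub>R b \<in> S" if "0 \<le> s" "s \<le> h" "0 \<le> t" "t \<le> h"
      "(a = u \<and> b = v) \<or> (a = v \<and> b = u)" for s t a b
    using near[OF that] r0 by (auto simp: r_def dist_commute)
  obtain s t where st: "0 < s" "s < h" "0 < t" "t < h" and
    e1: "f (x + h *\<^sub>R u + h *\<^sub>R v) - f (x + h *\<^sub>R u) - f (x + h *\<^sub>R v) + f x =
        h * h * hess f (x + s *\<^sub>R u + t *\<^sub>R v) v u"
    using double_difference[OF f h, of x u v] inS by blast
  obtain s' t' where st': "0 < s'" "s' < h" "0 < t'" "t' < h" and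
    e2: "f (x + h *\<^sub>R v + h *\<^sub>R u) - f (x + h *\<^sub>R v) - f (x + h *\<^sub>R u) + f x =
        h * h * hess f (x + s' *\<^sub>R v + t' *\<^sub>R u) u v"
    using double_difference[OF f h, of x v u] inS by blast
  have "h * h * hess f (x + s *\<^sub>R u + t *\<^sub>R v) v u = h * h * hess f (x + s' *\<^sub>R v + t' *\<^sub>R u) u v"
    unfolding e1[symmetric] e2[symmetric] by (simp add: algebra_simps)
  then have "hess f (x + s *\<^sub>R u + t *\<^sub>R v) v u = hess f (x + s' *\<^sub>R v + t' *\<^sub>R u) u v"
      using h by simp
  moreover have "dist (hess f (x + s *\<^sub>R u + t *\<^sub>R v) v u) (hess f x v u) < \<epsilon>"
    using near[of s t u v] st by (intro r2) (auto simp: r_def)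
  moreover have "dist (hess f (x + s' *\<^sub>R v + t' *\<^sub>R u) u v) (hess f x u v) < \<epsilon>"
    using near[of s' t' v u] st' by (intro r1) (auto simp: r_def)
  moreover have "\<bar>b - c\<bar> \<le> \<bar>a - c\<bar> + \<bar>a - b\<bar>" for a b c :: real by linarith
  ultimately have "\<bar>hess f x u v - hess f x v u\<bar> < \<epsilon> + \<epsilon>"
    unfolding dist_real_def by (metis add_strict_mono order_le_less_trans)
  then show False by (simp add: \<epsilon>_def)
qed

section \<open>The Levi form in terms of the real Hessian\<close>

lemma frechet_derivative_of_real:
  assumes "smooth_on S u" "p \<in> S"
  shows "frechet_derivative (\<lambda>q. complex_of_real (u q)) (at p) =
      (\<lambda>v. of_real (frechet_derivative u (at p) v))"
  using has_derivative_of_real[OF smooth_on_has_derivative[OF assms]]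
  by (rule frechet_derivative_at[symmetric])

lemma levi_coeff_hess:
  assumes S: "open S" and u: "smooth_on S u" and p: "p \<in> S"
  shows "levi_coeff u p a b =
    (of_real (hess u p (axis a 1) (axis b 1) + hess u p (axis a \<i>) (axis b \<i>))
     + \<i> * of_real (hess u p (axis a 1) (axis b \<i>) - hess u p (axis a \<i>) (axis b 1))) / 4"
proof -
  have zbar: "pd_zbar b (\<lambda>q. complex_of_real (u q)) q =
     (of_real (frechet_derivative u (at q) (axis b 1)) +
         \<i> * of_real (frechet_derivative u (at q) (axis b \<i>))) / 2"
    if "q \<in> S" for q
    using that by (simp add: pd_zbar_def frechet_derivative_of_real[OF u])
  have "((\<lambda>q. (of_real (frechet_derivative u (at q) (axis b 1)) +
          \<i> * of_real (frechet_derivative u (at q) (axis b \<i>))) / 2) has_derivative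
       (\<lambda>v. (of_real (hess u p v (axis b 1)) + \<i> * of_real (hess u p v (axis b \<i>))) / 2)) (at p)"
    by (intro bounded_linear.has_derivative[OF bounded_linear_divide] has_derivative_add
        has_derivative_mult_right has_derivative_of_real
          hess_has_derivative[OF u p])
  then have "(pd_zbar b (\<lambda>q. complex_of_real (u q)) has_derivative
       (\<lambda>v. (of_real (hess u p v (axis b 1)) + \<i> * of_real (hess u p v (axis b \<i>))) / 2)) (at p)"
    by (rule has_derivative_transform_within_open[OF _ S p]) (simp add: zbar)
  from frechet_derivative_at[OF this, symmetric] show ?thesis
    by (simp add: levi_coeff_def pd_z_def field_simps)
qed

lemma axis_complex_expand: "axis a (c::complex) = Re c *\<^sub>R axis a 1 + Im c *\<^sub>R axis a \<i>"
  by (auto simp: vec_eq_iff axis_def complex_eq_iff)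

lemma vec_sum_axis: "(X :: 'a::comm_monoid_add^'k) = (\<Sum>a\<in>UNIV. axis a (X $ a))"
  by (auto simp: vec_eq_iff axis_def if_distrib cong: if_cong)

lemma first_factor_sum_axis:
  "(\<xi>, 0 :: 'b::real_vector) = (\<Sum>j\<in>UNIV. \<xi> $ j *\<^sub>R (axis j (1::real), 0 :: 'b))"
  by (auto simp: prod_eq_iff fst_sum snd_sum vec_eq_iff axis_def if_distrib cong: if_cong)

lemma linear_on_first_factor:
  fixes L :: "(real^'n) \<times> 'b::real_vector \<Rightarrow> real"
  assumes "linear L"
  shows "L (\<xi>, 0) = (\<Sum>j\<in>UNIV. \<xi> $ j * L (axis j 1, 0))"
  by (subst first_factor_sum_axis)
     (simp add: linear_sum[OF assms] linear_cmul[OF assms] del: scaleR_Pair)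

text \<open>Complex multilinear algebra for a real bilinear \<open>H\<close>: the combination
  \<open>H(X, Y) + H(\<i>X, \<i>Y) + \<i> (H(X, \<i>Y) - H(\<i>X, Y))\<close> is complex linear in \<open>X\<close> and conjugate linear in \<open>Y\<close>, so
  it is determined by its values at the unit vectors, which are four times the Levi coefficients.\<close>

lemma levi_form_hess:
  fixes u :: "complex^'k \<Rightarrow> real"
  assumes S: "open S" and u: "smooth_on S u" and p: "p \<in> S"
  shows "(\<Sum>a\<in>UNIV. \<Sum>b\<in>UNIV. levi_coeff u p a b * X $ a * cnj (Y $ b)) =
    (of_real (hess u p X Y + hess u p (\<i> *s X) (\<i> *s Y)) + \<i> * of_real (hess u p X (\<i> *s Y) -
        hess u p (\<i> *s X) Y)) / 4"
proof -
  note l1 = linear_hess_left[OF u p] and l2 = linear_hess_right[OF S u p]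
  have ax: "hess u p (axis a c) (axis b d) =
      Re c * Re d * hess u p (axis a 1) (axis b 1) + Re c * Im d * hess u p (axis a 1) (axis b \<i>)
      + Im c * Re d * hess u p (axis a \<i>) (axis b 1) +
          Im c * Im d * hess u p (axis a \<i>) (axis b \<i>)" for a b c d
    unfolding axis_complex_expand[of a c] axis_complex_expand[of b d]
    by (simp only: linear_add[OF l1] linear_add[OF l2] linear_cmul[OF l1] linear_cmul[OF l2])
       (simp add: algebra_simps)
  have sum: "(\<Sum>a\<in>UNIV. \<Sum>b\<in>UNIV. hess u p (axis a (X $ a)) (axis b (Y $ b))) = hess u p X Y" for X Y
  proof -
    have "hess u p V Y = (\<Sum>b\<in>UNIV. hess u p V (axis b (Y $ b)))" for V
      by (subst vec_sum_axis[of Y]) (rule linear_sum[OF l2])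
    moreover have "hess u p X Y = (\<Sum>a\<in>UNIV. hess u p (axis a (X $ a)) Y)"
      by (subst vec_sum_axis[of X]) (rule linear_sum[OF l1])
    ultimately show ?thesis by simp
  qed
  have L: "levi_coeff u p a b * c * cnj d =
      (of_real (hess u p (axis a c) (axis b d) + hess u p (axis a (\<i> * c)) (axis b (\<i> * d)))
       + \<i> * of_real (hess u p (axis a c) (axis b (\<i> * d)) -
           hess u p (axis a (\<i> * c)) (axis b d))) / 4" for a b c d
    unfolding levi_coeff_hess[OF assms] ax[of a c b d] ax[of a c b "\<i> * d"] ax[of a "\<i> * c" b d]
      ax[of a "\<i> * c" b "\<i> * d"]
    by (simp add: complex_eq_iff algebra_simps)
  have "(\<Sum>a\<in>UNIV. \<Sum>b\<in>UNIV. levi_coeff u p a b * X $ a * cnj (Y $ b)) =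
    (\<Sum>a\<in>UNIV. \<Sum>b\<in>UNIV.
      (of_real (hess u p (axis a (X $ a)) (axis b (Y $ b)) +
          hess u p (axis a ((\<i> *s X) $ a)) (axis b ((\<i> *s Y) $ b)))
       + \<i> * of_real (hess u p (axis a (X $ a)) (axis b ((\<i> *s Y) $ b)) -
           hess u p (axis a ((\<i> *s X) $ a)) (axis b (Y $ b)))) / 4)"
    by (simp only: L vector_smult_component)
  also have "\<dots> = (of_real (hess u p X Y + hess u p (\<i> *s X) (\<i> *s Y))
       + \<i> * of_real (hess u p X (\<i> *s Y) - hess u p (\<i> *s X) Y)) / 4"
    unfolding sum[symmetric, of X Y] sum[symmetric, of X "\<i> *s Y"] sum[symmetric, of "\<i> *s X" Y]
        sum[symmetric, of "\<i> *s X" "\<i> *s Y"]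
    by (simp only: of_real_add of_real_diff of_real_sum ring_distribs add_divide_distrib
         diff_divide_distrib sum.distrib sum_subtractf sum_distrib_left sum_divide_distrib)
  finally show ?thesis .
qed

text \<open>Antisymmetrizing the Levi form cancels its symmetric real part; this is where the symmetry of the
  Hessian is needed.\<close>

lemma i_ddbar_hess:
  fixes u :: "complex^'k \<Rightarrow> real"
  assumes S: "open S" and u: "smooth_on S u" and p: "p \<in> S"
  shows "i_ddbar u p X Y = of_real ((hess u p (\<i> *s X) Y - hess u p X (\<i> *s Y)) / 2)"
proof -
  have "i_ddbar u p X Y =
     \<i> * ((\<Sum>a\<in>UNIV. \<Sum>b\<in>UNIV. levi_coeff u p a b * X $ a * cnj (Y $ b)) -
          (\<Sum>a\<in>UNIV. \<Sum>b\<in>UNIV. levi_coeff u p a b * Y $ a * cnj (X $ b)))"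
    by (simp add: i_ddbar_def sum_subtractf algebra_simps)
  then show ?thesis
    unfolding levi_form_hess[OF assms] hess_symmetric[OF assms, of Y] hess_symmetric[OF assms, of
        "\<i> *s Y"]
    by (simp add: complex_eq_iff field_simps)
qed

lemma bilinear_i_ddbar:
  assumes S: "open S" and u: "smooth_on S u" and p: "p \<in> S"
  shows "bilinear (i_ddbar u p)" and "i_ddbar u p X X = 0"
proof -
  note l1 = linear_hess_left[OF u p] and l2 = linear_hess_right[OF S u p]
  note l = linear_add[OF l1] linear_add[OF l2] linear_cmul[OF l1] linear_cmul[OF l2]
  have J: "\<i> *s (X + Y) = \<i> *s X + \<i> *s Y" "\<i> *s (c *\<^sub>R X) = c *\<^sub>R (\<i> *s X)"
      for X Y :: "complex^'k" and c
    by (simp_all add: vec_eq_iff algebra_simps)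
  show "bilinear (i_ddbar u p)"
    unfolding bilinear_def
    by (intro conjI allI linearI)
       (simp_all add: i_ddbar_hess[OF assms] l J scaleR_conv_of_real[where ?'a =
           complex] field_simps)
  show "i_ddbar u p X X = 0"
    using hess_symmetric[OF assms, of X "\<i> *s X"] by (simp add: i_ddbar_hess[OF assms])
qed

section \<open>Logarithmic coordinates and the torus action\<close>

lemma has_derivative_vec:
  fixes f :: "'a::real_normed_vector \<Rightarrow> 'b::euclidean_space^'k"
  assumes "\<And>i. ((\<lambda>x. f x $ i) has_derivative (\<lambda>v. f' v $ i)) (at x)"
  shows "(f has_derivative f') (at x)"
  by (subst has_derivative_componentwise_within)
     (auto simp: Basis_vec_def inner_axis intro!: has_derivative_inner_left assms)

lemma linear_proj_w: "linear proj_w"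
  by (rule linearI) (auto simp: proj_w_def vec_eq_iff)

lemma bounded_linear_proj_w: "bounded_linear proj_w"
  using linear_proj_w linear_conv_bounded_linear by blast

lemma proj_w_J [simp]: "proj_w (\<i> *s X) = \<i> *s proj_w X"
  by (simp add: proj_w_def vec_eq_iff)

text \<open>The moduli and the \<open>w\<close>-coordinates determine a point up to the torus; logarithms of the moduli are
  used because the equations of the level set become those of a gradient in them. The map \<open>exp_coords\<close> is
  the section with positive real \<open>z\<close>, and \<open>dlog p\<close> is the derivative of \<open>log_coords\<close> at \<open>p\<close>.\<close>

definition log_coords :: "complex^('n::finite + 'm::finite) \<Rightarrow> (real^'n) \<times> (complex^'m)" where
  "log_coords p = (\<chi> i. ln (cmod (p $ Inl i)), proj_w p)"

definition exp_coords :: "(real^'n::finite) \<times> (complex^'m::finite) \<Rightarrow> complex^('n + 'm)" where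
  "exp_coords q = (\<chi> k. case k of Inl i \<Rightarrow> of_real (exp (fst q $ i)) | Inr a \<Rightarrow> snd q $ a)"

definition dlog :: "complex^('n::finite + 'm::finite) \<Rightarrow> complex^('n + 'm) \<Rightarrow>
    (real^'n) \<times> (complex^'m)" where
  "dlog p X = (\<chi> i. Re (X $ Inl i / p $ Inl i), proj_w X)"

lemma exp_coords_nth [simp]:
  "exp_coords q $ Inl i = of_real (exp (fst q $ i))" "exp_coords q $ Inr a = snd q $ a"
  by (simp_all add: exp_coords_def)

lemma proj_w_exp_coords [simp]: "proj_w (exp_coords q) = snd q"
  by (simp add: proj_w_def vec_eq_iff)

lemma log_exp_coords [simp]: "log_coords (exp_coords q) = q"
  by (simp add: log_coords_def vec_eq_iff prod_eq_iff)

lemma snd_log_coords [simp]: "snd (log_coords p) = proj_w p"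
  by (simp add: log_coords_def)

lemma snd_dlog [simp]: "snd (dlog p X) = proj_w X"
  by (simp add: dlog_def)

lemma tcoord_exp_log_coords:
  assumes "\<And>i. p $ Inl i \<noteq> 0"
  shows "tcoord (exp_coords (log_coords p)) = tcoord p"
  using assms by (simp add: tcoord_def vec_eq_iff log_coords_def)

text \<open>Locally the function is the real part of a branch of the logarithm, with complex derivative \<open>1/z\<close>;
  computing with the norm instead avoids the choice of a branch.\<close>

lemma has_derivative_ln_cmod:
  assumes "z \<noteq> 0"
  shows "((\<lambda>z. ln (cmod z)) has_derivative (\<lambda>h. Re (h / z))) (at z)"
proof -
  have "((\<lambda>z. ln (cmod z)) has_derivative (\<lambda>h. (h \<bullet> sgn z) * inverse (cmod z))) (at z)"
    using assms by (auto intro!: derivative_eq_intros has_derivative_norm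
        simp: mult.commute inner_commute)
  moreover have "(h \<bullet> sgn z) * inverse (cmod z) = Re (h / z)" for h
  proof -
    have "Re (h / z) = (h \<bullet> z) / (cmod z)\<^sup>2"
      by (simp add: Re_divide inner_complex_def cmod_power2)
    then show ?thesis by (simp add: sgn_div_norm power2_eq_square divide_inverse)
  qed
  ultimately show ?thesis by simp
qed

lemma log_coords_has_derivative:
  assumes "\<And>i. p $ Inl i \<noteq> 0"
  shows "(log_coords has_derivative dlog p) (at p)"
  unfolding log_coords_def dlog_def
proof (rule has_derivative_Pair, rule has_derivative_vec)
  show "((\<lambda>p. (\<chi> i. ln (cmod (p $ Inl i))) $ i) has_derivative (\<lambda>X. (\<chi> i. Re (X $ Inl i / p $ Inl
      i)) $ i)) (at p)" for i
    using has_derivative_compose[OF bounded_linear_imp_has_derivative[OF bounded_linear_vec_nth]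
        has_derivative_ln_cmod[OF assms]]
    by simp
  show "(proj_w has_derivative proj_w) (at p)"
    by (rule bounded_linear_imp_has_derivative[OF bounded_linear_proj_w])
qed

text \<open>The second derivative of the logarithmic coordinates involves the two vectors only through the
  complex products \<open>X\<^sub>i Y\<^sub>i\<close>, so it is unchanged when a factor \<open>\<i>\<close> moves from one vector to the other. For this
  reason it does not contribute to \<open>\<i> \<partial>\<partial>\<^sup>*\<rho>\<close>.\<close>

lemma dlog_has_derivative:
  assumes "\<And>i. p $ Inl i \<noteq> 0"
  shows "((\<lambda>p. dlog p X) has_derivative (\<lambda>Y. (\<chi> i. -
      Re (X $ Inl i * Y $ Inl i / (p $ Inl i)\<^sup>2), 0))) (at p)"
  unfolding dlog_def
proof (rule has_derivative_Pair[OF _ has_derivative_const], rule has_derivative_vec)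
  fix i
  have "((\<lambda>p. p $ Inl i) has_derivative (\<lambda>Y. Y $ Inl i)) (at p)"
    by (rule bounded_linear_imp_has_derivative[OF bounded_linear_vec_nth])
  then have "((\<lambda>p. Re (X $ Inl i / p $ Inl i)) has_derivative
      (\<lambda>Y. - Re (X $ Inl i * Y $ Inl i / (p $ Inl i)\<^sup>2))) (at p)"
    using assms[of i] by (auto intro!: derivative_eq_intros simp: power2_eq_square field_simps)
  then show "((\<lambda>p. (\<chi> i. Re (X $ Inl i / p $ Inl i)) $ i) has_derivative
     (\<lambda>Y. (\<chi> i. - Re (X $ Inl i * Y $ Inl i / (p $ Inl i)\<^sup>2)) $ i)) (at p)"
    by simp
qed

lemma Ck_on_exp_coords:
  "Ck_on k (exp_coords :: (real^'n::finite) \<times> (complex^'m::finite) \<Rightarrow> _) UNIV"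
proof -
  define L :: "(real^'n) \<times> (complex^'m) \<Rightarrow> complex^('n + 'm)"
    where "L q = (\<chi> k. case k of Inl i \<Rightarrow> 0 | Inr a \<Rightarrow> snd q $ a)" for q
  have "linear L"
    by (rule linearI) (auto simp: L_def vec_eq_iff split: sum.splits)
  then have L: "bounded_linear L" using linear_conv_bounded_linear by blast
  have b: "bounded_linear (\<lambda>q :: (real^'n) \<times> (complex^'m). fst q $ i)" for i
    using bounded_linear_compose[OF bounded_linear_vec_nth bounded_linear_fst] .
  have "exp_coords q = (\<Sum>i\<in>UNIV. exp (fst q $ i) *\<^sub>R axis (Inl i) 1) + L q" for q
  proof -
    have "exp_coords q $ k = ((\<Sum>i\<in>UNIV. exp (fst q $ i) *\<^sub>R axis (Inl i) 1) + L q) $ k" for k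
      by (cases k) (auto simp: L_def axis_def if_distrib of_real_def cong: if_cong)
    then show ?thesis by (simp add: vec_eq_iff)
  qed
  moreover have "Ck_on k (\<lambda>q. (\<Sum>i\<in>UNIV. exp (fst q $ i) *\<^sub>R axis (Inl i) 1) + L q) UNIV"
    by (intro Ck_on_add Ck_on_sum Ck_on_scaleR Ck_on_const Ck_on_compose[OF _ _ _ Ck_on_exp]
        Ck_on_linear[OF _ b] Ck_on_linear[OF _ L] Ck_on_id) auto
  ultimately show ?thesis by presburger
qed

lemma open_mfd:
  fixes U :: "(complex^'m::finite) set"
  assumes "open U" shows "open (mfd U :: (complex^('n::finite + 'm)) set)"
proof -
  have "(mfd U :: (complex^('n + 'm)) set) = (\<Inter>i. {p. p $ Inl i \<noteq> 0}) \<inter> proj_w -` U"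
    by (auto simp: mfd_def)
  moreover have "open {p :: complex^('n + 'm). p $ Inl i \<noteq> 0}" for i
    by (intro open_Collect_neq continuous_intros)
  moreover have "open (proj_w -` U :: (complex^('n + 'm)) set)"
    using assms bounded_linear_proj_w by (intro open_vimage) (auto intro: linear_continuous_on)
  ultimately show ?thesis by (auto intro!: open_Int open_INT)
qed

lemma w_chart_orbit: "w_chart (torus_orbit p) = proj_w p"
proof -
  have "proj_w (torus_act \<theta> p) = proj_w p" for \<theta>
    by (simp add: proj_w_def torus_act_def)
  moreover have "(\<chi> i. 1) \<in> (torus :: (complex^'n::finite) set)" by (simp add: torus_def)
  ultimately have "proj_w ` torus_orbit p = {proj_w p}"
    unfolding torus_orbit_def by (auto simp: image_iff)
  then show ?thesis by (simp add: w_chart_def)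
qed

lemma torus_orbit_eqI:
  fixes p q :: "complex^('n::finite + 'm::finite)"
  assumes p: "\<And>i. p $ Inl i \<noteq> 0" and q: "\<And>i. q $ Inl i \<noteq> 0" and eq: "log_coords p = log_coords q"
  shows "torus_orbit p = torus_orbit q"
proof -
  have sub: "torus_orbit p \<subseteq> torus_orbit q"
    if p: "\<And>i. p $ Inl i \<noteq> 0" and q: "\<And>i. q $ Inl i \<noteq> 0" and eq: "log_coords p = log_coords q"
    for p q :: "complex^('n + 'm)"
  proof -
    define \<tau> :: "complex^'n" where "\<tau> = (\<chi> i. p $ Inl i / q $ Inl i)"
    have n: "cmod (p $ Inl i) = cmod (q $ Inl i)" for i
    proof -
      have "ln (cmod (p $ Inl i)) = ln (cmod (q $ Inl i))"
        using eq by (simp add: log_coords_def vec_eq_iff)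
      then show ?thesis using p[of i] q[of i] by simp
    qed
    have w: "p $ Inr a = q $ Inr a" for a
      using eq by (simp add: log_coords_def proj_w_def vec_eq_iff)
    have "torus_act \<theta> p = torus_act (\<chi> i. \<theta> $ i * \<tau> $ i) q" for \<theta>
      using q w by (auto simp: torus_act_def \<tau>_def vec_eq_iff split: sum.splits)
    moreover have "(\<chi> i. \<theta> $ i * \<tau> $ i) \<in> torus" if "\<theta> \<in> torus" for \<theta>
      using that n q by (simp add: torus_def \<tau>_def norm_mult norm_divide)
    ultimately show ?thesis unfolding torus_orbit_def by blast
  qed
  show ?thesis using sub[of p q] sub[of q p] assms by auto
qed

lemma shifted_potential_log:
  assumes "\<And>i. p $ Inl i \<noteq> 0"
  shows "shifted_potential \<rho> l p = \<rho> p - 2 * (\<Sum>j\<in>UNIV. l $ j * fst (log_coords p) $ j)"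
proof -
  have "ln (tcoord p $ j) = 2 * ln (cmod (p $ Inl j))" for j
    using assms[of j] by (simp add: tcoord_def ln_realpow)
  then show ?thesis
    by (simp add: shifted_potential_def log_coords_def sum_distrib_left algebra_simps)
qed

section \<open>The potential in logarithmic coordinates\<close>

locale toric_potential =
  fixes U :: "(complex^'m::finite) set" and \<rho> :: "complex^('n::finite + 'm) \<Rightarrow> real"
  assumes open_U: "open U" and smooth: "smooth_on (mfd U) \<rho>"
    and invariant: "T_invariant_on (mfd U) \<rho>" and psh: "strictly_psh_on (mfd U) \<rho>"
begin

definition F :: "(real^'n) \<times> (complex^'m) \<Rightarrow> real" where
  "F q = \<rho> (exp_coords q)"

abbreviation log_dom :: "((real^'n) \<times> (complex^'m)) set" where
  "log_dom \<equiv> UNIV \<times> U"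

lemma open_log_dom: "open log_dom"
  using open_U by (simp add: open_Times)

lemma exp_coords_mfd: "q \<in> log_dom \<Longrightarrow> exp_coords q \<in> mfd U"
  by (auto simp: mfd_def)

lemma mfd_nonzero: "p \<in> mfd U \<Longrightarrow> p $ Inl i \<noteq> 0"
  by (simp add: mfd_def)

lemma log_coords_in_log_dom: "p \<in> mfd U \<Longrightarrow> log_coords p \<in> log_dom"
  by (auto simp: mfd_def log_coords_def)

lemma potential_eq_F: "p \<in> mfd U \<Longrightarrow> \<rho> p = F (log_coords p)"
proof -
  assume p: "p \<in> mfd U"
  obtain f where f: "\<And>p. p \<in> mfd U \<Longrightarrow> \<rho> p = f (tcoord p) (proj_w p)"
    using invariant unfolding T_invariant_on_def by blast
  show ?thesis
    using f[OF p] f[OF exp_coords_mfd[OF log_coords_in_log_dom[OF p]]] tcoord_exp_log_coords[of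
        p] mfd_nonzero[OF p]
    by (simp add: F_def)
qed

lemma smooth_F: "smooth_on log_dom F"
  unfolding smooth_on_def F_def
proof
  show "Ck_on k (\<lambda>q. \<rho> (exp_coords q)) log_dom" for k
    by (rule Ck_on_compose[OF open_log_dom open_mfd[OF open_U] _ smooth_on_Ck[OF smooth]
          Ck_on_subset[OF Ck_on_exp_coords]])
       (auto intro: exp_coords_mfd)
qed

abbreviation DF where "DF q \<equiv> frechet_derivative F (at q)"

lemma linear_DF: "q \<in> log_dom \<Longrightarrow> linear (DF q)"
  using smooth_on_has_derivative[OF smooth_F] has_derivative_linear by blast

lemma potential_has_derivative:
  assumes p: "p \<in> mfd U"
  shows "(\<rho> has_derivative (\<lambda>X. DF (log_coords p) (dlog p X))) (at p)"
proof -
  have "((\<lambda>p. F (log_coords p)) has_derivative (\<lambda>X. DF (log_coords p) (dlog p X))) (at p)"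
    using has_derivative_compose[OF log_coords_has_derivative[OF mfd_nonzero[OF p]]
        smooth_on_has_derivative[OF smooth_F log_coords_in_log_dom[OF p]]] .
  then show ?thesis
    by (rule has_derivative_transform_within_open[OF _ open_mfd[OF open_U] p]) (simp add:
        potential_eq_F)
qed

lemma hess_potential:
  assumes p: "p \<in> mfd U"
  shows "hess \<rho> p X Y = hess F (log_coords p) (dlog p X) (dlog p Y) +
     DF (log_coords p) (\<chi> i. - Re (Y $ Inl i * X $ Inl i / (p $ Inl i)\<^sup>2), 0)"
  using hess_eqI[OF open_mfd[OF open_U] p potential_has_derivative
      has_derivative_moving_direction[OF open_log_dom smooth_F log_coords_has_derivative[OF
          mfd_nonzero[OF p]]
        dlog_has_derivative[OF mfd_nonzero[OF p]] log_coords_in_log_dom[OF p]]] by simp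

lemma moment_F:
  assumes p: "p \<in> mfd U"
  shows "moment \<rho> p $ j = of_real (DF (log_coords p) (axis j 1, 0) / 2)"
proof -
  note lin = linear_DF[OF log_coords_in_log_dom[OF p]]
  have "dlog p (axis (Inl j) c) = Re (c / p $ Inl j) *\<^sub>R (axis j 1, 0)" for c
    by (auto simp: dlog_def axis_def vec_eq_iff proj_w_def)
  then have D: "frechet_derivative (\<lambda>q. complex_of_real (\<rho> q)) (at p) (axis (Inl j) c) =
     of_real (Re (c / p $ Inl j) * DF (log_coords p) (axis j 1, 0))" for c
    unfolding frechet_derivative_of_real[OF smooth p]
      frechet_derivative_at[OF potential_has_derivative[OF p], symmetric]
    by (simp only: linear_cmul[OF lin] real_scaleR_def)
  have "of_real (Re (1 / z)) - \<i> * of_real (Re (\<i> / z)) = 1 / z" for z :: complex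
  proof -
    have "of_real (Re y) - \<i> * of_real (Re (\<i> * y)) = y" for y by (simp add: complex_eq_iff)
    from this[of "1 / z"] show ?thesis by simp
  qed
  then have "pd_z (Inl j) (\<lambda>q. complex_of_real (\<rho> q)) p =
     1 / p $ Inl j * of_real (DF (log_coords p) (axis j 1, 0)) / 2"
    unfolding pd_z_def D by (simp add: algebra_simps)
  then show ?thesis using mfd_nonzero[OF p, of j] by (simp add: moment_def)
qed

lemma level_set_iff:
  "p \<in> level_set U \<rho> l \<longleftrightarrow> p \<in> mfd U \<and> (\<forall>j. DF (log_coords p) (axis j 1, 0) = 2 * l $ j)"
proof (cases "p \<in> mfd U")
  case True
  show ?thesis unfolding level_set_def mem_Collect_eq moment_F[OF True] of_real_eq_iff by auto
qed (simp add: level_set_def)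

text \<open>The Levi form of \<open>\<rho>\<close> is evaluated at the vector \<open>X\<close> with \<open>X\<^sub>j = z\<^sub>j \<xi>\<^sub>j\<close>, which covers
  \<open>(\<xi>, 0)\<close>, while \<open>\<i>X\<close> is tangent to the torus orbit and covers 0.\<close>

lemma hess_F_positive:
  assumes q: "q \<in> log_dom" and \<xi>: "\<xi> \<noteq> 0"
  shows "hess F q (\<xi>, 0) (\<xi>, 0) > 0"
proof -
  define p where "p = exp_coords q"
  have p: "p \<in> mfd U" using exp_coords_mfd[OF q] by (simp add: p_def)
  define X :: "complex^('n + 'm)" where "X = (\<chi> k. case k of Inl i \<Rightarrow>
      of_real (exp (fst q $ i) * \<xi> $ i) | Inr a \<Rightarrow> 0)"
  have X_nth: "X $ Inl i = of_real (exp (fst q $ i) * \<xi> $ i)" "X $ Inr a = 0" for i a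
    by (simp_all add: X_def)
  obtain i where "\<xi> $ i \<noteq> 0" using \<xi> by (auto simp: vec_eq_iff)
  then have "X $ Inl i \<noteq> 0" by (simp add: X_nth)
  then have "X \<noteq> 0" by auto
  then have "0 < Re (\<Sum>a\<in>UNIV. \<Sum>b\<in>UNIV. levi_coeff \<rho> p a b * X $ a * cnj (X $ b))"
    using psh p by (auto simp: strictly_psh_on_def)
  then have pos: "0 < hess \<rho> p X X + hess \<rho> p (\<i> *s X) (\<i> *s X)"
    unfolding levi_form_hess[OF open_mfd[OF open_U] smooth p] by simp
  have 1: "dlog p X = (\<xi>, 0)" "dlog p (\<i> *s X) = 0"
    by (auto simp: dlog_def p_def vec_eq_iff proj_w_def X_nth prod_eq_iff)
  have 2: "log_coords p = q" by (simp add: p_def)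
  have "DF q (\<chi> i. - Re (X $ Inl i * X $ Inl i / (p $ Inl i)\<^sup>2), 0) +
      DF q (\<chi> i. - Re ((\<i> *s X) $ Inl i * (\<i> *s X) $ Inl i / (p $ Inl i)\<^sup>2), 0) = DF q 0"
    by (subst linear_add[OF linear_DF[OF q], symmetric])
       (auto intro!: arg_cong[where f = "DF q"] simp: vec_eq_iff prod_eq_iff algebra_simps)
  then show ?thesis using pos unfolding hess_potential[OF p] 1 2
    using linear_0[OF linear_DF[OF q]] linear_0[OF linear_hess_left[OF smooth_F q]] by simp
qed

text \<open>A gradient of a strictly convex function is injective: on the segment from \<open>x\<close> to \<open>y\<close> the derivative
  in direction \<open>y - x\<close> strictly increases.\<close>

lemma DF_injective:
  assumes x: "(x, w) \<in> log_dom" and eq: "\<And>j. DF (x, w) (axis j 1, 0) = DF (y, w) (axis j 1, 0)"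
  shows "x = y"
proof (rule ccontr)
  assume ne: "x \<noteq> y"
  define \<xi> where "\<xi> = y - x"
  have \<xi>: "\<xi> \<noteq> 0" using ne by (simp add: \<xi>_def)
  have inD: "(x + s *\<^sub>R \<xi>, w) \<in> log_dom" for s using x by simp
  have expand: "DF (z, w) (\<xi>, 0) = (\<Sum>j\<in>UNIV. \<xi> $ j * DF (z, w) (axis j 1, 0))" for z
    using x by (intro linear_on_first_factor linear_DF) auto
  have D: "((\<lambda>s. DF (x + s *\<^sub>R \<xi>, w) (\<xi>, 0)) has_real_derivative hess F (x +
      s *\<^sub>R \<xi>, w) (\<xi>, 0) (\<xi>, 0)) (at s)" for s
  proof -
    have "((\<lambda>s. (x + s *\<^sub>R \<xi>, w)) has_derivative (\<lambda>r. r *\<^sub>R (\<xi>, 0))) (at s)"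
      by (auto intro!: derivative_eq_intros)
    from has_derivative_compose[OF this hess_has_derivative[OF smooth_F inD]]
    show ?thesis
      by (simp add: has_field_derivative_def linear_cmul[OF linear_hess_left[OF smooth_F inD]]
          mult.commute[of _ "hess _ _ _ _"] del: scaleR_Pair)
  qed
  have "\<exists>s>0. s < 1 \<and> DF (x + 1 *\<^sub>R \<xi>, w) (\<xi>, 0) - DF (x + 0 *\<^sub>R \<xi>, w) (\<xi>, 0) =
      (1 - 0) * hess F (x + s *\<^sub>R \<xi>, w) (\<xi>, 0) (\<xi>, 0)"
    by (rule MVT2) (use D in auto)
  then obtain s where "DF (y, w) (\<xi>, 0) - DF (x, w) (\<xi>, 0) = hess F (x + s *\<^sub>R \<xi>, w) (\<xi>, 0) (\<xi>, 0)"
    by (auto simp: \<xi>_def)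
  then show False using hess_F_positive[OF inD \<xi>, of s] by (simp add: expand eq)
qed

end

section \<open>The level set as a graph over the base\<close>

locale toric_reduction = toric_potential U \<rho>
  for U :: "(complex^'m::finite) set" and \<rho> :: "complex^('n::finite + 'm) \<Rightarrow> real" +
  fixes l :: "real^'n"
begin

text \<open>Twice the moment map in logarithmic coordinates, paired with \<open>w\<close>. Solving the level
  equation for \<open>x\<close> amounts to inverting this map between spaces of equal dimension, so
  invariance of domain and the inverse function rule take the place of the implicit function theorem.\<close>

definition moment_pair :: "(real^'n) \<times> (complex^'m) \<Rightarrow> (real^'n) \<times> (complex^'m)" where
  "moment_pair q = ((\<chi> j. DF q (axis j 1, 0)), snd q)"

definition reduced_base :: "(complex^'m) set" where
  "reduced_base = {w. (2 *\<^sub>R l, w) \<in> moment_pair ` log_dom}"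

text \<open>The value at \<open>w\<close> is the point \<open>(x(w), w)\<close> of the level set in logarithmic coordinates; outside
  \<open>reduced_base\<close> it is arbitrary.\<close>

definition lift :: "complex^'m \<Rightarrow> (real^'n) \<times> (complex^'m)" where
  "lift w = inv_into log_dom moment_pair (2 *\<^sub>R l, w)"

abbreviation Dlift where "Dlift w \<equiv> frechet_derivative lift (at w)"

lemma inj_moment_pair: "inj_on moment_pair log_dom"
proof (rule inj_onI)
  fix q r assume qr: "q \<in> log_dom" "r \<in> log_dom" "moment_pair q = moment_pair r"
  obtain x w y v where [simp]: "q = (x, w)" "r = (y, v)" by (meson surj_pair)
  have "w = v" "\<And>j. DF (x, w) (axis j 1, 0) = DF (y, v) (axis j 1, 0)"
    using qr(3) by (simp_all add: moment_pair_def vec_eq_iff)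
  then show "q = r" using DF_injective[of x w y] qr(1) by auto
qed

lemma moment_pair_has_derivative:
  assumes q: "q \<in> log_dom"
  shows "(moment_pair has_derivative (\<lambda>v. ((\<chi> j. hess F q v (axis j 1, 0)), snd v))) (at q)"
  unfolding moment_pair_def
proof (rule has_derivative_Pair, rule has_derivative_vec)
  show "((\<lambda>q. (\<chi> j. DF q (axis j 1, 0)) $ i) has_derivative (\<lambda>v. (\<chi> j. hess F q v (axis j 1, 0))
      $ i)) (at q)" for i
    using hess_has_derivative[OF smooth_F q] by simp
qed (auto intro!: derivative_eq_intros)

lemma continuous_moment_pair: "continuous_on log_dom moment_pair"
  using moment_pair_has_derivative has_derivative_continuous continuous_at_imp_continuous_on
      by blast

lemma open_moment_pair_image: "open (moment_pair ` log_dom)"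
  by (rule invariance_of_domain[OF continuous_moment_pair open_log_dom inj_moment_pair])

lemma open_reduced_base: "open reduced_base"
proof -
  have "reduced_base = (\<lambda>w. (2 *\<^sub>R l, w)) -` (moment_pair ` log_dom)" by (auto
      simp: reduced_base_def)
  also have "open \<dots>" by (intro open_vimage open_moment_pair_image continuous_intros)
  finally show ?thesis .
qed

lemma moment_pair_lift: "w \<in> reduced_base \<Longrightarrow> moment_pair (lift w) = (2 *\<^sub>R l, w)"
  unfolding reduced_base_def lift_def by (simp add: f_inv_into_f)

lemma lift_in_log_dom: "w \<in> reduced_base \<Longrightarrow> lift w \<in> log_dom"
  unfolding reduced_base_def lift_def mem_Collect_eq by (rule inv_into_into)

lemma snd_lift: "w \<in> reduced_base \<Longrightarrow> snd (lift w) = w"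
  using moment_pair_lift[of w] by (simp add: moment_pair_def)

lemma DF_lift: "w \<in> reduced_base \<Longrightarrow> DF (lift w) (axis j 1, 0) = 2 * l $ j"
  using moment_pair_lift[of w] by (simp add: moment_pair_def vec_eq_iff)

lemma reduced_base_subset: "reduced_base \<subseteq> U"
  using lift_in_log_dom snd_lift by (metis mem_Times_iff subsetI)

lemma lift_unique:
  assumes q: "q \<in> log_dom" and eq: "\<And>j. DF q (axis j 1, 0) = 2 * l $ j"
  shows "snd q \<in> reduced_base" "lift (snd q) = q"
proof -
  have moment_pair: "(2 *\<^sub>R l, snd q) = moment_pair q" using eq
      by (simp add: moment_pair_def vec_eq_iff)
  then show "snd q \<in> reduced_base" using q by (auto simp: reduced_base_def)
  show "lift (snd q) = q" unfolding lift_def moment_pair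
      by (rule inv_into_f_f[OF inj_moment_pair q])
qed

lemma hess_F_nondegenerate:
  assumes q: "q \<in> log_dom" and "\<And>j. hess F q (\<xi>, 0) (axis j 1, 0) = 0"
  shows "\<xi> = 0"
proof (rule ccontr)
  assume "\<xi> \<noteq> 0"
  then have "0 < hess F q (\<xi>, 0) (\<xi>, 0)" by (rule hess_F_positive[OF q])
  then show False
    using assms(2) linear_on_first_factor[OF linear_hess_right[OF open_log_dom smooth_F q], of
        "(\<xi>, 0)" \<xi>] by simp
qed

text \<open>Invariance of domain makes the inverse of \<open>moment_pair\<close> continuous, and positivity of the Hessian
  makes the derivative of \<open>moment_pair\<close> injective, so the inverse is differentiable.\<close>

lemma lift_has_derivative:
  assumes w: "w \<in> reduced_base"
  shows "(lift has_derivative Dlift w) (at w)"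
proof -
  let ?L = "\<lambda>v. ((\<chi> j. hess F (lift w) v (axis j 1, 0)), snd v)"
  note q = lift_in_log_dom[OF w]
  have der: "(moment_pair has_derivative ?L) (at (lift w))"
      by (rule moment_pair_has_derivative[OF q])
  then have lin: "linear ?L" by (rule has_derivative_linear)
  have "inj ?L"
  proof (subst linear_injective_0[OF lin], intro allI impI)
    fix v :: "(real^'n) \<times> (complex^'m)" assume v: "?L v = 0"
    then have "v = (fst v, 0)" "\<And>j. hess F (lift w) v (axis j 1, 0) = 0"
      by (auto simp: prod_eq_iff vec_eq_iff)
    then show "v = 0" using hess_F_nondegenerate[OF q, of "fst v"]
        by (metis prod.collapse zero_prod_def)
  qed
  then obtain G where G: "linear G" "G \<circ> ?L = id"
    using linear_injective_left_inverse[OF lin] by blast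
  have y: "(2 *\<^sub>R l, w) \<in> moment_pair ` log_dom" using w by (simp add: reduced_base_def)
  have "continuous_on (moment_pair ` log_dom) (inv_into log_dom moment_pair)"
    using inj_moment_pair by (intro continuous_on_inverse_open open_log_dom
        continuous_moment_pair) auto
  then have "continuous (at (2 *\<^sub>R l, w)) (inv_into log_dom moment_pair)"
    using open_moment_pair_image y continuous_on_eq_continuous_at by blast
  then have "(inv_into log_dom moment_pair has_derivative G) (at (2 *\<^sub>R l, w))"
    using G der linear_conv_bounded_linear
    by (intro has_derivative_inverse_basic[OF _ _ _ _ open_moment_pair_image y]) (auto
        simp: lift_def f_inv_into_f)
  moreover have "((\<lambda>w. (2 *\<^sub>R l, w)) has_derivative (\<lambda>V. (0, V))) (at w)"
    by (auto intro!: derivative_eq_intros)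
  ultimately have "(lift has_derivative (\<lambda>V. G (0, V))) (at w)"
    unfolding lift_def by (rule has_derivative_compose[rotated])
  then show ?thesis using differentiableI frechet_derivative_works by blast
qed

lemma snd_Dlift:
  assumes w: "w \<in> reduced_base" shows "snd (Dlift w V) = V"
proof -
  have "((\<lambda>w. snd (lift w)) has_derivative (\<lambda>V. snd (Dlift w V))) (at w)"
    by (intro has_derivative_snd lift_has_derivative w)
  moreover have "((\<lambda>w. snd (lift w)) has_derivative (\<lambda>V. V)) (at w)"
    by (rule has_derivative_transform_within_open[OF has_derivative_ident open_reduced_base w])
        (simp add: snd_lift)
  ultimately show ?thesis using has_derivative_unique by metis
qed

text \<open>The derivative of the level equation: vectors tangent to the level set are orthogonal, for the
  Hessian of \<open>F\<close>, to the fibre directions.\<close>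

lemma hess_F_Dlift:
  assumes w: "w \<in> reduced_base" shows "hess F (lift w) (Dlift w V) (\<eta>, 0) = 0"
proof -
  have "hess F (lift w) (Dlift w V) (axis j 1, 0) = 0" for j
  proof -
    have "((\<lambda>w. DF (lift w) (axis j 1, 0)) has_derivative (\<lambda>V. hess F (lift w) (Dlift w V) (axis
        j 1, 0))) (at w)"
      using has_derivative_compose[OF lift_has_derivative[OF w] hess_has_derivative[OF smooth_F
          lift_in_log_dom[OF w]]] .
    moreover have "((\<lambda>w. DF (lift w) (axis j 1, 0)) has_derivative (\<lambda>V. 0)) (at w)"
      by (rule has_derivative_transform_within_open[OF has_derivative_const open_reduced_base w])
          (simp add: DF_lift)
    ultimately show ?thesis using has_derivative_unique by metis
  qed
  then show ?thesis
    using linear_on_first_factor[OF linear_hess_right[OF open_log_dom smooth_F lift_in_log_dom[OF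
        w]], where \<xi> = \<eta>] by simp
qed

text \<open>Bootstrapping. By \<open>hess_F_Dlift\<close> the \<open>x\<close>-part \<open>\<xi>\<close> of the derivative of \<open>lift\<close> in direction \<open>V\<close> solves the
  linear system \<open>A \<xi> = b\<close>, where \<open>A\<close> is the Hessian of \<open>F\<close> in \<open>x\<close> at \<open>lift w\<close> and \<open>b\<close> its negated mixed part.
  Cramer's rule expresses \<open>\<xi>\<close> through determinants with entries as often differentiable as \<open>lift\<close>, which
  therefore gains one order.\<close>

lemma Ck_on_lift: "Ck_on k lift reduced_base"
proof (induction k)
  case 0
  then show ?case
    using lift_has_derivative has_derivative_continuous continuous_at_imp_continuous_on
        by (metis Ck_on.simps(1))
next
  case (Suc k)
  have C2: "Ck_on k (\<lambda>w. hess F (lift w) u v) reduced_base" for u v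
    unfolding hess_def
    by (rule Ck_on_compose[OF open_reduced_base open_log_dom _ smooth_on_Ck[OF
        smooth_on_frechet[OF smooth_on_frechet[OF smooth_F]]] Suc])
       (use lift_in_log_dom in blast)
  define A :: "complex^'m \<Rightarrow> real^'n^'n" where "A w =
      (\<chi> i j. hess F (lift w) (axis j 1, 0) (axis i 1, 0))" for w
  have A: "A w *v \<xi> = (\<chi> i. hess F (lift w) (\<xi>, 0) (axis i 1, 0))" if "w \<in> reduced_base" for w \<xi>
    using linear_on_first_factor[OF linear_hess_left[OF smooth_F lift_in_log_dom[OF that]],
        where \<xi> = \<xi>]
    by (simp add: A_def matrix_vector_mult_def vec_eq_iff mult.commute)
  have det: "det (A w) \<noteq> 0" if w: "w \<in> reduced_base" for w
  proof -
    have "\<xi> = 0" if "A w *v \<xi> = 0" for \<xi>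
      using that hess_F_nondegenerate[OF lift_in_log_dom[OF w]] by (simp add: A[OF w] vec_eq_iff)
    then show ?thesis using invertible_det_nz invertible_left_inverse matrix_left_invertible_ker
        by metis
  qed
  have CA: "Ck_on k (\<lambda>w. A w $ i $ j) reduced_base" for i j using C2 by (simp add: A_def)
  show ?case
  proof (rule Ck_on_SucI[OF open_reduced_base lift_has_derivative])
    fix V
    define B :: "'n \<Rightarrow> complex^'m \<Rightarrow> real^'n^'n" where
      "B k w = (\<chi> i j. if j = k then - hess F (lift w) (0, V) (axis i 1, 0) else A w $ i $ j)"
          for k w
    have "Ck_on k (\<lambda>w. B i w $ a $ b) reduced_base" for i a b
      using Ck_on_linear[OF open_reduced_base bounded_linear_minus[OF bounded_linear_ident] C2] CA
      by (cases "b = i") (simp_all add: B_def)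
    then have Ck: "Ck_on k (\<lambda>w. ((\<chi> i. det (B i w) * inverse (det (A w))), V)) reduced_base"
      using det CA by (intro Ck_on_Pair Ck_on_vec open_reduced_base Ck_on_const)
        (auto intro!: Ck_on_mult Ck_on_inverse Ck_on_det open_reduced_base)
    have eq: "Dlift w V = ((\<chi> i. det (B i w) * inverse (det (A w))), V)"
        if w: "w \<in> reduced_base" for w
    proof -
      define \<xi> where "\<xi> = fst (Dlift w V)"
      have e: "Dlift w V = (\<xi>, 0) + (0, V)" using snd_Dlift[OF w, of V]
          by (simp add: \<xi>_def prod_eq_iff)
      have "hess F (lift w) (\<xi>, 0) (axis i 1, 0) + hess F (lift w) (0, V) (axis i 1, 0) = 0" for i
        using hess_F_Dlift[OF w, of V "axis i 1"] unfolding e linear_add[OF linear_hess_left[OF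
            smooth_F lift_in_log_dom[OF w]]] .
      then have "(A w *v \<xi>) $ i = - hess F (lift w) (0, V) (axis i 1, 0)" for i
        by (simp add: A[OF w] eq_neg_iff_add_eq_0)
      then have "det (B i w) = \<xi> $ i * det (A w)" for i
        using cramer_lemma[of i "A w" \<xi>] by (simp add: B_def cong: if_cong)
      then show ?thesis using det[OF w] by (simp add: e vec_eq_iff)
    qed
    show "Ck_on k (\<lambda>w. Dlift w V) reduced_base"
      by (rule Ck_on_cong[OF open_reduced_base _ Ck]) (simp add: eq)
  qed
qed

lemma level_set_lift:
  "p \<in> level_set U \<rho> l \<longleftrightarrow> p \<in> mfd U \<and> proj_w p \<in> reduced_base \<and> log_coords p = lift (proj_w p)"
proof (cases "p \<in> mfd U")
  case True
  show ?thesis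
    using lift_unique[OF log_coords_in_log_dom[OF True]] DF_lift[of "proj_w p"] True
    unfolding level_set_iff by (metis snd_log_coords)
qed (simp add: level_set_def)

lemma exp_lift_level_set: "w \<in> reduced_base \<Longrightarrow> exp_coords (lift w) \<in> level_set U \<rho> l"
  using exp_coords_mfd lift_in_log_dom by (simp add: level_set_lift snd_lift)

lemma proj_level_set: "proj_w ` level_set U \<rho> l = reduced_base"
proof
  show "reduced_base \<subseteq> proj_w ` level_set U \<rho> l"
    using exp_lift_level_set snd_lift by (metis image_eqI proj_w_exp_coords subsetI)
qed (auto simp: level_set_lift)

lemma chart_image_reduced_base: "chart_image U \<rho> l = reduced_base"
  unfolding chart_image_def reduced_space_def image_image w_chart_orbit proj_level_set ..

lemma inj_w_chart: "inj_on w_chart (reduced_space U \<rho> l)"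
proof (rule inj_onI)
  fix P Q assume PQ: "P \<in> reduced_space U \<rho> l" "Q \<in> reduced_space U \<rho> l" "w_chart P = w_chart Q"
  obtain p q where p: "p \<in> level_set U \<rho> l" "P = torus_orbit p" and q: "q \<in> level_set U \<rho> l" "Q =
      torus_orbit q"
    using PQ(1,2) unfolding reduced_space_def by blast
  have "proj_w p = proj_w q" using PQ(3) by (simp add: p q w_chart_orbit)
  then have "log_coords p = log_coords q" using p q by (simp add: level_set_lift)
  then show "P = Q"
    unfolding p q using p(1) q(1) mfd_nonzero by (intro torus_orbit_eqI) (auto simp: level_set_def)
qed

section \<open>The reduced potential and the reduced form\<close>

definition shifted_F :: "(real^'n) \<times> (complex^'m) \<Rightarrow> real" where
  "shifted_F q = F q - 2 * (\<Sum>j\<in>UNIV. l $ j * fst q $ j)"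

lemma shifted_potential_lift:
  assumes "p \<in> level_set U \<rho> l"
  shows "shifted_potential \<rho> l p = shifted_F (lift (proj_w p))"
proof -
  have p: "p \<in> mfd U" "log_coords p = lift (proj_w p)" using assms by (auto simp: level_set_lift)
  show ?thesis
    using shifted_potential_log[of p \<rho> l, OF mfd_nonzero[OF p(1)]] potential_eq_F[OF p(1)]
    by (simp add: shifted_F_def p(2))
qed

abbreviation R where "R \<equiv> reduced_potential U \<rho> l"

lemma reduced_potential_lift:
  assumes w: "w \<in> reduced_base" shows "R w = shifted_F (lift w)"
proof -
  have "shifted_potential \<rho> l ` {p \<in> level_set U \<rho> l. proj_w p = w} = {shifted_F (lift w)}"
    using exp_lift_level_set[OF w] shifted_potential_lift snd_lift[OF w]
    by (auto simp: image_iff intro!: exI[of _ "exp_coords (lift w)"])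
  then show ?thesis by (simp add: reduced_potential_def descended_def)
qed

text \<open>The envelope property: in direction \<open>(\<xi>, 0)\<close> the derivative of \<open>F\<close> is \<open>2 l \<bullet> \<xi>\<close> on the level set, and this
  is exactly what the subtracted linear term contributes.\<close>

lemma reduced_potential_has_derivative:
  assumes w: "w \<in> reduced_base" shows "(R has_derivative (\<lambda>V. DF (lift w) (0, V))) (at w)"
proof -
  note q = lift_in_log_dom[OF w]
  note lin = linear_DF[OF q]
  have "bounded_linear (\<lambda>q :: (real^'n) \<times> (complex^'m). fst q $ j)" for j
    using bounded_linear_compose[OF bounded_linear_vec_nth bounded_linear_fst] .
  then have "((\<lambda>w. shifted_F (lift w)) has_derivative
      (\<lambda>V. DF (lift w) (Dlift w V) - 2 * (\<Sum>j\<in>UNIV. l $ j * fst (Dlift w V) $ j))) (at w)"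
    unfolding shifted_F_def
    by (intro has_derivative_diff has_derivative_mult_right has_derivative_sum
        has_derivative_compose[OF lift_has_derivative[OF w] smooth_on_has_derivative[OF smooth_F q]]
        bounded_linear.has_derivative[OF _ lift_has_derivative[OF w]])
  moreover have "DF (lift w) (Dlift w V) - 2 * (\<Sum>j\<in>UNIV. l $ j * fst (Dlift w V) $ j) =
      DF (lift w) (0, V)" for V
  proof -
    have "Dlift w V = (fst (Dlift w V), 0) + (0, V)" using snd_Dlift[OF w, of V]
        by (simp add: prod_eq_iff)
    then have "DF (lift w) (Dlift w V) = DF (lift w) (fst (Dlift w V), 0) + DF (lift w) (0, V)"
      using linear_add[OF lin] by metis
    also have "DF (lift w) (fst (Dlift w V), 0) = 2 * (\<Sum>j\<in>UNIV. l $ j * fst (Dlift w V) $ j)"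
      unfolding linear_on_first_factor[OF lin, of "fst (Dlift w V)"] DF_lift[OF w]
          by (simp add: sum_distrib_left algebra_simps)
    finally show ?thesis by simp
  qed
  ultimately have "((\<lambda>w. shifted_F (lift w)) has_derivative (\<lambda>V. DF (lift w) (0, V))) (at w)"
      by simp
  then show ?thesis
    by (rule has_derivative_transform_within_open[OF _ open_reduced_base w]) (simp add:
        reduced_potential_lift)
qed

lemma smooth_reduced_potential: "smooth_on reduced_base R"
  unfolding smooth_on_def
proof
  fix k
  have Dk: "Ck_on k (\<lambda>w. DF (lift w) (0, V)) reduced_base" for k V
    by (rule Ck_on_compose[OF open_reduced_base open_log_dom _ smooth_on_Ck[OF
        smooth_on_frechet[OF smooth_F]] Ck_on_lift])
       (use lift_in_log_dom in blast)
  have "Ck_on (Suc k) R reduced_base"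
    by (rule Ck_on_SucI[OF open_reduced_base reduced_potential_has_derivative Dk])
  then show "Ck_on k R reduced_base" by (rule Ck_on_SucD)
qed

lemma hess_reduced_potential:
  assumes w: "w \<in> reduced_base" shows "hess R w V W = hess F (lift w) (Dlift w V) (0, W)"
  by (rule hess_eqI[OF open_reduced_base w reduced_potential_has_derivative])
     (use has_derivative_compose[OF lift_has_derivative[OF w] hess_has_derivative[OF smooth_F
         lift_in_log_dom[OF w]]] in auto)

text \<open>A curve in the level set satisfies \<open>log_coords (\<gamma> s) = lift (proj_w (\<gamma> s))\<close>; both sides are
  differentiated at 0.\<close>

lemma tangent_dlog:
  assumes p: "p \<in> level_set U \<rho> l" and X: "X \<in> tangent_vectors (level_set U \<rho> l) p"
  shows "dlog p X = Dlift (proj_w p) (proj_w X)"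
proof -
  have pm: "p \<in> mfd U" and pC: "proj_w p \<in> reduced_base" using p by (auto simp: level_set_lift)
  obtain \<gamma> e where \<gamma>: "\<gamma> 0 = p" "e > 0" "\<And>s. \<bar>s\<bar> < e \<Longrightarrow> \<gamma> s \<in> level_set U \<rho> l"
    and D: "(\<gamma> has_derivative (\<lambda>r. r *\<^sub>R X)) (at 0)"
    using X unfolding tangent_vectors_def has_vector_derivative_def by auto
  have 1: "((\<lambda>s. log_coords (\<gamma> s)) has_derivative (\<lambda>r. dlog p (r *\<^sub>R X))) (at 0)"
    using has_derivative_compose[OF D, of log_coords "dlog p"] log_coords_has_derivative[OF
        mfd_nonzero[OF pm]] \<gamma>(1)
    by simp
  have "((\<lambda>s. proj_w (\<gamma> s)) has_derivative (\<lambda>r. proj_w (r *\<^sub>R X))) (at 0)"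
    by (rule bounded_linear.has_derivative[OF bounded_linear_proj_w D])
  then have "((\<lambda>s. lift (proj_w (\<gamma> s))) has_derivative (\<lambda>r. Dlift (proj_w p) (proj_w (r *\<^sub>R X))))
      (at 0)"
    using has_derivative_compose[of "\<lambda>s. proj_w (\<gamma> s)" _ 0 UNIV lift] lift_has_derivative[OF pC]
        \<gamma>(1) by auto
  then have "((\<lambda>s. log_coords (\<gamma> s)) has_derivative (\<lambda>r. Dlift (proj_w p) (proj_w (r *\<^sub>R X))))
      (at 0)"
    by (rule has_derivative_transform_within_open[of _ _ _ _ "{-e<..<e}"])
       (use \<gamma> in \<open>auto simp: level_set_lift\<close>)
  from fun_cong[OF has_derivative_unique[OF this 1], of 1] show ?thesis by simp
qed

text \<open>A direction \<open>W\<close> is realized by following the line \<open>w + s W\<close> in the base, keeping the angles of \<open>p\<close> and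
  adjusting the moduli by \<open>x(w + s W) - x(w)\<close>.\<close>

lemma proj_tangent_surj:
  assumes p: "p \<in> level_set U \<rho> l"
  shows "proj_w ` tangent_vectors (level_set U \<rho> l) p = UNIV"
proof -
  define w where "w = proj_w p"
  have pm: "p \<in> mfd U" and wC: "w \<in> reduced_base" and pl: "log_coords p = lift w"
    using p by (auto simp: level_set_lift w_def)
  have "W \<in> proj_w ` tangent_vectors (level_set U \<rho> l) p" for W
  proof -
    define \<gamma> :: "real \<Rightarrow> complex^('n + 'm)" where
      "\<gamma> s = (\<chi> k. case k of Inl i \<Rightarrow> p $ Inl i * of_real (exp (fst (lift (w + s *\<^sub>R W)) $ i -
          fst (lift w) $ i))
                 | Inr a \<Rightarrow> (w + s *\<^sub>R W) $ a)" for s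
    have \<gamma>_nth: "\<gamma> s $ Inl i = p $ Inl i * of_real (exp (fst (lift (w + s *\<^sub>R W)) $ i -
        fst (lift w) $ i))"
      "\<gamma> s $ Inr a = (w + s *\<^sub>R W) $ a" for s i a
      by (simp_all add: \<gamma>_def)
    define X :: "complex^('n + 'm)" where
      "X = (\<chi> k. case k of Inl i \<Rightarrow> p $ Inl i * of_real (fst (Dlift w W) $ i) | Inr a \<Rightarrow> W $ a)"
    have X_nth: "X $ Inl i = p $ Inl i * of_real (fst (Dlift w W) $ i)" "X $ Inr a = W $ a" for i a
      by (simp_all add: X_def)
    have proj\<gamma>: "proj_w (\<gamma> s) = w + s *\<^sub>R W" for s
      by (simp add: proj_w_def \<gamma>_nth vec_eq_iff)
    have "\<gamma> 0 = p"
    proof -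
      have "\<gamma> 0 $ k = p $ k" for k
        by (cases k) (simp_all add: \<gamma>_nth w_def proj_w_def)
      then show ?thesis by (simp add: vec_eq_iff)
    qed
    moreover have "\<exists>e>0. \<forall>s. \<bar>s\<bar> < e \<longrightarrow> \<gamma> s \<in> level_set U \<rho> l"
    proof -
      have "open ((\<lambda>s. w + s *\<^sub>R W) -` reduced_base)"
          by (intro open_vimage open_reduced_base continuous_intros)
      moreover have "0 \<in> (\<lambda>s. w + s *\<^sub>R W) -` reduced_base" using wC by simp
      ultimately obtain e where e: "e > 0" "ball 0 e \<subseteq> (\<lambda>s. w + s *\<^sub>R W) -` reduced_base"
        using open_contains_ball by blast
      have "\<gamma> s \<in> level_set U \<rho> l" if s: "\<bar>s\<bar> < e" for s
      proof -
        have sC: "w + s *\<^sub>R W \<in> reduced_base" using e s by (auto simp: subset_iff)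
        have "ln (cmod (p $ Inl i)) = fst (lift w) $ i" for i
          using pl by (metis fst_conv log_coords_def vec_lambda_beta)
        then have "log_coords (\<gamma> s) = lift (w + s *\<^sub>R W)"
          using snd_lift[OF sC] mfd_nonzero[OF pm]
          by (simp add: log_coords_def proj\<gamma> prod_eq_iff vec_eq_iff \<gamma>_nth norm_mult ln_mult)
        moreover have "\<gamma> s \<in> mfd U"
          using sC reduced_base_subset mfd_nonzero[OF pm] by (auto simp: mfd_def proj\<gamma> \<gamma>_nth)
        ultimately show ?thesis using sC by (simp add: level_set_lift proj\<gamma>)
      qed
      then show ?thesis using e(1) by blast
    qed
    moreover have "(\<gamma> has_derivative (\<lambda>r. r *\<^sub>R X)) (at 0)"
    proof (rule has_derivative_vec)
      fix k
      have line: "((\<lambda>s. w + s *\<^sub>R W) has_derivative (\<lambda>r. r *\<^sub>R W)) (at 0)"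
        by (auto intro!: derivative_eq_intros)
      have lw: "(lift has_derivative Dlift w) (at (w + 0 *\<^sub>R W))"
          using lift_has_derivative[OF wC] by simp
      show "((\<lambda>s. \<gamma> s $ k) has_derivative (\<lambda>r. (r *\<^sub>R X) $ k)) (at 0)"
      proof (cases k)
        case (Inl i)
        have "bounded_linear (\<lambda>q :: (real^'n) \<times> (complex^'m). fst q $ i)"
          using bounded_linear_compose[OF bounded_linear_vec_nth bounded_linear_fst] .
        from bounded_linear.has_derivative[OF this has_derivative_compose[OF line lw]]
        have "((\<lambda>s. fst (lift (w + s *\<^sub>R W)) $ i) has_derivative (\<lambda>r. r * fst (Dlift w W) $ i))
            (at 0)"
          by (simp add: linear_cmul[OF has_derivative_linear[OF lift_has_derivative[OF wC]]])
        then have "((\<lambda>s. p $ Inl i * of_real (exp (fst (lift (w + s *\<^sub>R W)) $ i -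
            fst (lift w) $ i)))
            has_derivative (\<lambda>r. p $ Inl i * of_real (r * fst (Dlift w W) $ i))) (at 0)"
          by (intro has_derivative_mult_right has_derivative_of_real) (auto
              intro!: derivative_eq_intros)
        then show ?thesis by (simp add: Inl \<gamma>_nth X_nth scaleR_conv_of_real[where ?'a =
            complex] algebra_simps)
      next
        case (Inr a)
        show ?thesis unfolding Inr \<gamma>_nth vector_scaleR_component X_nth
          by (auto intro!: derivative_eq_intros)
      qed
    qed
    ultimately have "X \<in> tangent_vectors (level_set U \<rho> l) p"
      unfolding tangent_vectors_def has_vector_derivative_def by blast
    moreover have "proj_w X = W" by (simp add: proj_w_def X_nth vec_eq_iff)
    ultimately show ?thesis by blast
  qed
  then show ?thesis by blast
qed

text \<open>For a tangent vector \<open>X\<close> the image of \<open>\<i>X\<close> under \<open>dlog p\<close> is \<open>(\<eta>, \<i> V)\<close>, where \<open>V\<close> is the projection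
  of \<open>X\<close> and \<open>\<eta>\<close> comes from its angular part. The Hessian of \<open>F\<close> pairs
  \<open>(\<eta>, 0)\<close> with tangent vectors to zero, so only the part \<open>(0, \<i> V)\<close> survives, as in the Hessian of the reduced potential.\<close>

lemma i_ddbar_reduced:
  assumes p: "p \<in> level_set U \<rho> l"
    and X: "X \<in> tangent_vectors (level_set U \<rho> l) p"
        and Y: "Y \<in> tangent_vectors (level_set U \<rho> l) p"
  shows "i_ddbar R (proj_w p) (proj_w X) (proj_w Y) = i_ddbar \<rho> p X Y"
proof -
  define w where "w = proj_w p"
  have pm: "p \<in> mfd U" and wC: "w \<in> reduced_base" and pl: "log_coords p = lift w"
    using p by (auto simp: level_set_lift w_def)
  note q = lift_in_log_dom[OF wC]
  note l1 = linear_hess_left[OF smooth_F q] and l2 = linear_hess_right[OF open_log_dom smooth_F q]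
  have J: "hess F (lift w) (Dlift w V) (dlog p (\<i> *s Z)) =
      hess F (lift w) (Dlift w V) (0, \<i> *s proj_w Z)" for V Z
  proof -
    have "dlog p (\<i> *s Z) = (fst (dlog p (\<i> *s Z)), 0) + (0, \<i> *s proj_w Z)"
      by (simp add: prod_eq_iff)
    then show ?thesis using linear_add[OF l2] hess_F_Dlift[OF wC] by (metis add_0)
  qed
  have tX: "dlog p X = Dlift w (proj_w X)" and tY: "dlog p Y = Dlift w (proj_w Y)"
    using tangent_dlog[OF p] X Y by (simp_all add: w_def)
  have "hess \<rho> p (\<i> *s X) Y - hess \<rho> p X (\<i> *s Y) =
     hess F (lift w) (dlog p (\<i> *s X)) (dlog p Y) - hess F (lift w) (dlog p X) (dlog p (\<i> *s Y))"
    by (simp add: hess_potential[OF pm] pl algebra_simps)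
  also have "\<dots> = hess F (lift w) (Dlift w (proj_w Y)) (0, \<i> *s proj_w X) -
      hess F (lift w) (Dlift w (proj_w X)) (0, \<i> *s proj_w Y)"
    unfolding tX tY hess_symmetric[OF open_log_dom smooth_F q, of "dlog p (\<i> *s X)"] J ..
  also have "\<dots> = hess R w (\<i> *s proj_w X) (proj_w Y) - hess R w (proj_w X) (\<i> *s proj_w Y)"
    unfolding hess_symmetric[OF open_reduced_base smooth_reduced_potential wC, of "\<i> *s proj_w X"]
    by (simp add: hess_reduced_potential[OF wC])
  finally show ?thesis
    unfolding i_ddbar_hess[OF open_mfd[OF open_U] smooth pm] w_def[symmetric]
      i_ddbar_hess[OF open_reduced_base smooth_reduced_potential wC] by simp
qed

lemma is_reduced_form_iff:
  "is_reduced_form U \<rho> l \<sigma> \<longleftrightarrow> (\<forall>w \<in> reduced_base. \<sigma> w = i_ddbar R w)"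
proof
  assume red: "is_reduced_form U \<rho> l \<sigma>"
  show "\<forall>w\<in>reduced_base. \<sigma> w = i_ddbar R w"
  proof (intro ballI ext)
    fix w V W assume w: "w \<in> reduced_base"
    then obtain p where p: "p \<in> level_set U \<rho> l" "w = proj_w p" using proj_level_set by blast
    obtain X where X: "X \<in> tangent_vectors (level_set U \<rho> l) p" "V = proj_w X"
      using proj_tangent_surj[OF p(1)] by blast
    obtain Y where Y: "Y \<in> tangent_vectors (level_set U \<rho> l) p" "W = proj_w Y"
      using proj_tangent_surj[OF p(1)] by blast
    show "\<sigma> w V W = i_ddbar R w V W"
      using red p X Y i_ddbar_reduced[OF p(1) X(1) Y(1)] by (simp add: is_reduced_form_def)
  qed
next
  assume eq: "\<forall>w\<in>reduced_base. \<sigma> w = i_ddbar R w"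
  have "two_form_on reduced_base \<sigma>"
    using eq bilinear_i_ddbar[OF open_reduced_base smooth_reduced_potential]
        by (simp add: two_form_on_def)
  moreover have "\<sigma> (proj_w p) = i_ddbar R (proj_w p)" if "p \<in> level_set U \<rho> l" for p
    using eq that by (simp add: level_set_lift)
  ultimately show "is_reduced_form U \<rho> l \<sigma>"
    by (simp add: is_reduced_form_def chart_image_reduced_base i_ddbar_reduced)
qed

end

theorem mainTheorem4:
  fixes U :: "(complex^'m) set"
    and \<rho> :: "complex^('n::finite + 'm) \<Rightarrow> real"
    and l :: "real^'n"
  assumes "open U" and "convex U"
    and "smooth_on (mfd U) \<rho>"
    and "T_invariant_on (mfd U) \<rho>"
    and "strictly_psh_on (mfd U) \<rho>"
  shows "inj_on w_chart (reduced_space U \<rho> l) \<and>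
    open (chart_image U \<rho> l) \<and> chart_image U \<rho> l \<subseteq> U \<and>
    (\<forall>p \<in> level_set U \<rho> l. proj_w ` tangent_vectors (level_set U \<rho> l) p = UNIV) \<and>
    (\<forall>p \<in> level_set U \<rho> l. reduced_potential U \<rho> l (proj_w p) = shifted_potential \<rho> l p) \<and>
    smooth_on (chart_image U \<rho> l) (reduced_potential U \<rho> l) \<and>
    (\<forall>\<sigma>. is_reduced_form U \<rho> l \<sigma> \<longleftrightarrow>
       (\<forall>w \<in> chart_image U \<rho> l. \<sigma> w = i_ddbar (reduced_potential U \<rho> l) w))"
proof -
  interpret toric_reduction U \<rho> l
    using assms by unfold_locales
  show ?thesis
    using inj_w_chart open_reduced_base reduced_base_subset proj_tangent_surj shifted_potential_lift smooth_reduced_potential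
    by (simp add: chart_image_reduced_base is_reduced_form_iff reduced_potential_lift level_set_lift)
qed

end
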